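(* Consider the iterates of sum-product GAMP (described in the context). Then for every $t$: (i) the updates for $\mathbf{x}^{t+1}$ and $\boldsymbol{\tau}_x^{t+1}$ are equivalent to $$(\mathbf{x}^{t+1},\boldsymbol{\tau}_x^{t+1})=\arg\min_{\bar{\mathbf{x}},\bar{\boldsymbol{\tau}}_x}\Big[L_{\rm SP}(\bar{\mathbf{x}},\mathbf{z}^t,\bar{\boldsymbol{\tau}}_x,\boldsymbol{\tau}_p^t,\mathbf{s}^t)+\tfrac12(\boldsymbol{\tau}_s^t)^T\mathbf{S}\bar{\boldsymbol{\tau}}_x+\tfrac12\|\bar{\mathbf{x}}-\mathbf{x}^t\|^2_{\boldsymbol{\tau}_r^t}\Big];$$ (ii) the updates yielding $\boldsymbol{\tau}_p^t,\mathbf{z}^t,\mathbf{s}^t,\boldsymbol{\tau}_s^t$ are equivalent to $\boldsymbol{\tau}_p^t=\mathbf{S}\boldsymbol{\tau}_x^t$, $\mathbf{z}^t=\arg\min_{\bar{\mathbf{z}}}\big[L_{\rm SP}(\mathbf{x}^t,\bar{\mathbf{z}},\boldsymbol{\tau}_x^t,\boldsymbol{\tau}_p^t,\mathbf{s}^{t-1})+\tfrac12\|\bar{\mathbf{z}}-\mathbf{A}\mathbf{x}^t\|^2_{\boldsymbol{\tau}_p^t}\big]$, $\mathbf{s}^t=\mathbf{s}^{t-1}+\frac{1}{\boldsymbol{\tau}_p^t}(\mathbf{z}^t-\mathbf{A}\mathbf{x}^t)$, $\boldsymbol{\tau}_s^t=2\frac{\partial}{\partial\boldsymbol{\tau}_p}L_{\rm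 SP}(\mathbf{x}^t,\mathbf{z}^t,\boldsymbol{\tau}_x^t,\boldsymbol{\tau}_p^t,\mathbf{s}^t)$. Moreover, any fixed point $(\hat{\mathbf{x}},\hat{\mathbf{z}},\boldsymbol{\tau}_x,\boldsymbol{\tau}_p,\mathbf{s})$ of sum-product GAMP is a critical point of the optimization $\min F_{\rm SP}(\bar{\mathbf{x}},\bar{\mathbf{z}},\bar{\boldsymbol{\tau}}_x,\bar{\boldsymbol{\tau}}_p)$ s.t. $\bar{\mathbf{z}}=\mathbf{A}\bar{\mathbf{x}}$, $\bar{\boldsymbol{\tau}}_p=\mathbf{S}\bar{\boldsymbol{\tau}}_x$ with Lagrangian $L_{\rm SP}$: namely $\hat{\mathbf{z}}=\mathbf{A}\hat{\mathbf{x}}$, $\boldsymbol{\tau}_p=\mathbf{S}\boldsymbol{\tau}_x$, and the function $(\bar{\mathbf{x}},\bar{\mathbf{z}},\bar{\boldsymbol{\tau}}_x)\mapsto L_{\rm SP}(\bar{\mathbf{x}},\bar{\mathbf{z}},\bar{\boldsymbol{\tau}}_x,\mathbf{S}\bar{\boldsymbol{\tau}}_x,\mathbf{s})$ has zero partial derivatives in $\bar{\mathbf{x}},\bar{\mathbf{z}},\bar{\boldsymbol{\tau}}_x$ at $(\hat{\mathbf{x}},\hat{\mathbf{z}},\boldsymbol{\tau}_x)$. In addition, the densities attaining the minima defining $F^x_{\rm SP}$ and $F^z_{\rm SP}$ (at the corresponding arguments $(\mathbf{x},\boldsymbol{\tau}_x)$ and $(\mathbf{z},\boldsymbol{\tau}_p)$)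 are $\hat b_x(\mathbf{x})=p(\mathbf{x}|\mathbf{r},\boldsymbol{\tau}_r)$ and $\hat b_z(\mathbf{z})=p(\mathbf{z}|\mathbf{p},\boldsymbol{\tau}_p)$.
   Context: All vector-vector products, quotients and inverses are componentwise; for positive $\boldsymbol{\tau}$, $\|\mathbf{v}\|^2_{\boldsymbol{\tau}}:=\sum_i|v_i|^2/\tau_i$. $\mathbf{A}\in\mathbb{R}^{m\times n}$, $\mathbf{S}:=|\mathbf{A}|^2$ (entrywise), $f_x(\mathbf{x})=\sum_j f_{x_j}(x_j)$, $f_z(\mathbf{z})=\sum_i f_{z_i}(z_i)$. Define densities $p(\mathbf{x}|\mathbf{r},\boldsymbol{\tau}_r)\propto\prod_{j}\exp[-f_{x_j}(x_j)-|x_j-r_j|^2/(2\tau_{r_j})]$ and $p(\mathbf{z}|\mathbf{p},\boldsymbol{\tau}_p)\propto\prod_i\exp[-f_{z_i}(z_i)-|z_i-p_i|^2/(2\tau_{p_i})]$, assumed normalizable; $\mathbb{E}(\cdot|\cdot)$ and $\mathrm{var}(\cdot|\cdot)$ denote mean and componentwise-variance vectors under them. Sum-product GAMP: initialize $\mathbf{x}^0$, positive $\boldsymbol{\tau}_x^0$, $\mathbf{s}^{-1}=\mathbf{0}$. For $t=0,1,\dots$: $\boldsymbol{\tau}_p^t=\mathbf{S}\boldsymbol{\tau}_x^t$; $\mathbf{p}^t=\mathbf{A}\mathbf{x}^t-\mathbf{s}^{t-1}\boldsymbol{\tau}_p^t$; $\mathbf{z}^t=\mathbb{E}(\mathbf{z}|\mathbf{p}^t,\boldsymbol{\tau}_p^t)$;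 $\boldsymbol{\tau}_z^t=\mathrm{var}(\mathbf{z}|\mathbf{p}^t,\boldsymbol{\tau}_p^t)$; $\mathbf{s}^t=(\mathbf{z}^t-\mathbf{p}^t)/\boldsymbol{\tau}_p^t$; $\boldsymbol{\tau}_s^t=1/\boldsymbol{\tau}_p^t-\boldsymbol{\tau}_z^t/(\boldsymbol{\tau}_p^t)^2$; $\boldsymbol{\tau}_r^t=1/(\mathbf{S}^T\boldsymbol{\tau}_s^t)$; $\mathbf{r}^t=\mathbf{x}^t+\boldsymbol{\tau}_r^t\mathbf{A}^T\mathbf{s}^t$; $\mathbf{x}^{t+1}=\mathbb{E}(\mathbf{x}|\mathbf{r}^t,\boldsymbol{\tau}_r^t)$; $\boldsymbol{\tau}_x^{t+1}=\mathrm{var}(\mathbf{x}|\mathbf{r}^t,\boldsymbol{\tau}_r^t)$ (all quantities assumed well defined and positive where required). A fixed point is a set of values left unchanged by an iteration. Objects: for a density $b$, $D(b\|e^{-f}):=\int b\log(b/e^{-f})$; densities range over product densities. $H_{\rm gauss}(b_z,\bar{\boldsymbol{\tau}}_p):=\sum_{i=1}^m[\frac{1}{2\bar\tau_{p_i}}\mathrm{var}(z_i|b_{z_i})+\frac12\log(2\pi\bar\tau_{p_i})]$. $F^x_{\rm SP}(\bar{\mathbf{x}},\bar{\boldsymbol{\tau}}_x):=\min_{b_x}D(b_x\|e^{-f_x})$ s.t. $\mathbb{E}(\mathbf{x}|b_x)=\bar{\mathbf{x}}$, $\mathrm{var}(\mathbf{x}|b_x)=\bar{\boldsymbol{\tau}}_x$;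 $F^z_{\rm SP}(\bar{\mathbf{z}},\bar{\boldsymbol{\tau}}_p):=\min_{b_z}[D(b_z\|e^{-f_z})+H_{\rm gauss}(b_z,\bar{\boldsymbol{\tau}}_p)]$ s.t. $\mathbb{E}(\mathbf{z}|b_z)=\bar{\mathbf{z}}$; $F_{\rm SP}:=F^x_{\rm SP}(\bar{\mathbf{x}},\bar{\boldsymbol{\tau}}_x)+F^z_{\rm SP}(\bar{\mathbf{z}},\bar{\boldsymbol{\tau}}_p)$; and the Lagrangian $L_{\rm SP}(\bar{\mathbf{x}},\bar{\mathbf{z}},\bar{\boldsymbol{\tau}}_x,\bar{\boldsymbol{\tau}}_p,\bar{\mathbf{s}}):=F_{\rm SP}(\bar{\mathbf{x}},\bar{\mathbf{z}},\bar{\boldsymbol{\tau}}_x,\bar{\boldsymbol{\tau}}_p)+\bar{\mathbf{s}}^T(\bar{\mathbf{z}}-\mathbf{A}\bar{\mathbf{x}})$. *)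

theory Defs
  imports "HOL-Analysis.Analysis"
begin

definition vmul :: "real^'n \<Rightarrow> real^'n \<Rightarrow> real^'n" where
  "vmul a b = (\<chi> i. a$i * b$i)"

definition vdiv :: "real^'n \<Rightarrow> real^'n \<Rightarrow> real^'n" where
  "vdiv a b = (\<chi> i. a$i / b$i)"

definition vupd :: "real^'n \<Rightarrow> 'n \<Rightarrow> real \<Rightarrow> real^'n" where
  "vupd v k u = (\<chi> i. if i = k then u else v$i)"

definition wnorm2 :: "real^'n \<Rightarrow> real^'n \<Rightarrow> real" where
  "wnorm2 v \<tau> = (\<Sum>i\<in>UNIV. (v$i)^2 / \<tau>$i)"

definition sqm :: "real^'n^'m \<Rightarrow> real^'n^'m" where
  "sqm A = (\<chi> i j. (A$i$j)^2)"

definition dmean :: "(real \<Rightarrow> real) \<Rightarrow> real" where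
  "dmean b = (LINT u|lborel. u * b u)"

definition dvar :: "(real \<Rightarrow> real) \<Rightarrow> real" where
  "dvar b = (LINT u|lborel. (u - dmean b)^2 * b u)"

text \<open>b is a probability density on the line with finite variance for which
  D(b || e^{-f}) = int b log(b / e^{-f}) = int (b ln b + b f) is well defined (finite).\<close>
definition dens_adm :: "(real \<Rightarrow> real) \<Rightarrow> (real \<Rightarrow> real) \<Rightarrow> bool" where
  "dens_adm f b \<longleftrightarrow> b \<in> borel_measurable lborel \<and> (\<forall>u. 0 \<le> b u) \<and>
     integrable lborel b \<and> (LINT u|lborel. b u) = 1 \<and>
     integrable lborel (\<lambda>u. u^2 * b u) \<and>
     integrable lborel (\<lambda>u. b u * ln (b u) + b u * f u)"

definition kl1 :: "(real \<Rightarrow> real) \<Rightarrow> (real \<Rightarrow> real) \<Rightarrow> real" where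
  "kl1 f b = (LINT u|lborel. b u * ln (b u) + b u * f u)"

text \<open>D(b || e^{-f}) for a product density b = prod_j b_j and separable f = sum_j f_j\<close>
definition KLprod :: "('n \<Rightarrow> real \<Rightarrow> real) \<Rightarrow> ('n \<Rightarrow> real \<Rightarrow> real) \<Rightarrow> real" where
  "KLprod f b = (\<Sum>j\<in>UNIV. kl1 (f j) (b j))"

definition gibbs_Z :: "(real \<Rightarrow> real) \<Rightarrow> real \<Rightarrow> real \<Rightarrow> real" where
  "gibbs_Z f r \<tau> = (LINT u|lborel. exp (- f u - (u - r)^2 / (2 * \<tau>)))"

definition gibbs :: "(real \<Rightarrow> real) \<Rightarrow> real \<Rightarrow> real \<Rightarrow> real \<Rightarrow> real" where
  "gibbs f r \<tau> u = exp (- f u - (u - r)^2 / (2 * \<tau>)) / gibbs_Z f r \<tau>"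

text \<open>the product density p(.|r,tau), given by its factors\<close>
definition post_dens :: "('n \<Rightarrow> real \<Rightarrow> real) \<Rightarrow> real^'n \<Rightarrow> real^'n \<Rightarrow> 'n \<Rightarrow> real \<Rightarrow> real" where
  "post_dens f r \<tau> = (\<lambda>j. gibbs (f j) (r$j) (\<tau>$j))"

definition post_mean :: "('n \<Rightarrow> real \<Rightarrow> real) \<Rightarrow> real^'n \<Rightarrow> real^'n \<Rightarrow> real^'n" where
  "post_mean f r \<tau> = (\<chi> j. dmean (gibbs (f j) (r$j) (\<tau>$j)))"

definition post_var :: "('n \<Rightarrow> real \<Rightarrow> real) \<Rightarrow> real^'n \<Rightarrow> real^'n \<Rightarrow> real^'n" where
  "post_var f r \<tau> = (\<chi> j. dvar (gibbs (f j) (r$j) (\<tau>$j)))"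

definition potential_ok :: "(real \<Rightarrow> real) \<Rightarrow> bool" where
  "potential_ok f \<longleftrightarrow> f \<in> borel_measurable borel \<and>
     (\<forall>r \<tau>. 0 < \<tau> \<longrightarrow>
        integrable lborel (\<lambda>u. exp (- f u - (u - r)^2 / (2 * \<tau>))) \<and>
        integrable lborel (\<lambda>u. u^2 * exp (- f u - (u - r)^2 / (2 * \<tau>))))"

section \<open>Free energies and Lagrangian (extended-real valued; Inf {} = \<infinity>)\<close>

definition feasible_x :: "('n \<Rightarrow> real \<Rightarrow> real) \<Rightarrow> ('n \<Rightarrow> real \<Rightarrow> real) \<Rightarrow> real^'n \<Rightarrow> real^'n \<Rightarrow> bool" where
  "feasible_x f b xb \<tau>x \<longleftrightarrow>
     (\<forall>j. dens_adm (f j) (b j) \<and> dmean (b j) = xb$j \<and> dvar (b j) = \<tau>x$j)"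

definition FxSP :: "('n \<Rightarrow> real \<Rightarrow> real) \<Rightarrow> real^'n \<Rightarrow> real^'n \<Rightarrow> ereal" where
  "FxSP f xb \<tau>x = Inf {ereal (KLprod f b) | b. feasible_x f b xb \<tau>x}"

definition Hgauss :: "('m \<Rightarrow> real \<Rightarrow> real) \<Rightarrow> real^'m \<Rightarrow> real" where
  "Hgauss b \<tau>p = (\<Sum>i\<in>UNIV. dvar (b i) / (2 * \<tau>p$i) + ln (2 * pi * \<tau>p$i) / 2)"

definition feasible_z :: "('m \<Rightarrow> real \<Rightarrow> real) \<Rightarrow> ('m \<Rightarrow> real \<Rightarrow> real) \<Rightarrow> real^'m \<Rightarrow> bool" where
  "feasible_z f b zb \<longleftrightarrow> (\<forall>i. dens_adm (f i) (b i) \<and> dmean (b i) = zb$i)"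

definition FzSP :: "('m \<Rightarrow> real \<Rightarrow> real) \<Rightarrow> real^'m \<Rightarrow> real^'m \<Rightarrow> ereal" where
  "FzSP f zb \<tau>p = Inf {ereal (KLprod f b + Hgauss b \<tau>p) | b. feasible_z f b zb}"

definition LSP :: "('n \<Rightarrow> real \<Rightarrow> real) \<Rightarrow> ('m \<Rightarrow> real \<Rightarrow> real) \<Rightarrow> real^'n^'m \<Rightarrow>
    real^'n \<Rightarrow> real^'m \<Rightarrow> real^'n \<Rightarrow> real^'m \<Rightarrow> real^'m \<Rightarrow> ereal" where
  "LSP fx fz A xb zb \<tau>x \<tau>p s = FxSP fx xb \<tau>x + FzSP fz zb \<tau>p + ereal (s \<bullet> (zb - A *v xb))"

definition attains_Fx :: "('n \<Rightarrow> real \<Rightarrow> real) \<Rightarrow> ('n \<Rightarrow> real \<Rightarrow> real) \<Rightarrow> real^'n \<Rightarrow> real^'n \<Rightarrow> bool" where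
  "attains_Fx f b xb \<tau>x \<longleftrightarrow> feasible_x f b xb \<tau>x \<and> ereal (KLprod f b) = FxSP f xb \<tau>x"

definition attains_Fz :: "('m \<Rightarrow> real \<Rightarrow> real) \<Rightarrow> ('m \<Rightarrow> real \<Rightarrow> real) \<Rightarrow> real^'m \<Rightarrow> real^'m \<Rightarrow> bool" where
  "attains_Fz f b zb \<tau>p \<longleftrightarrow> feasible_z f b zb \<and> ereal (KLprod f b + Hgauss b \<tau>p) = FzSP f zb \<tau>p"

definition unique_argmin :: "('a \<Rightarrow> ereal) \<Rightarrow> 'a set \<Rightarrow> 'a \<Rightarrow> bool" where
  "unique_argmin J D a \<longleftrightarrow> a \<in> D \<and> (\<forall>y\<in>D. J a \<le> J y) \<and> (\<forall>y\<in>D. J y \<le> J a \<longrightarrow> y = a)"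

definition sprev :: "(nat \<Rightarrow> real^'m) \<Rightarrow> nat \<Rightarrow> real^'m" where
  "sprev s t = (if t = 0 then 0 else s (t - 1))"

end

theory Submission
  imports Defs
begin

text \<open>
  Relative to a Gibbs density \<open>g = p(\<cdot>|r, \<tau>)\<close>, the quantity
  \<open>D(b \<parallel> e\<^bsup>-f\<^esup>) + E\<^sub>b (u - r)\<^sup>2 / (2 \<tau>) + ln Z\<close> is the relative entropy of \<open>b\<close>
  with respect to \<open>g\<close>. After completing squares, each of the two GAMP objectives is, up to a constant,
  a sum over coordinates of infima of this excess under moment constraints, so \<open>g\<close> attains the minimum. An
  infimum under a moment constraint need not be attained, so uniqueness of the moments comes from a
  quantitative bound: testing against small quadratics shows that the excess is at least quadratic in
  the deviation of the moments. Conversely, bounded perturbations of \<open>g\<close> reach all nearby moments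
  with excess at most quadratic. The two bounds squeeze the free energies between functions with equal
  derivatives, which gives all the derivatives needed.
\<close>

section \<open>Densities with finite variance\<close>

text \<open>\<open>potential_ok\<close> asks for normalizability at every variance, not only at the
  current one. Comparison with a variance four times as large makes small quadratic tilts of a Gibbs
  density integrable. This is what drives the quadratic lower bound, and the admissible range
  \<open>1 / (32 * \<tau>)\<close> for the tilt is fixed by that comparison. Three obstacles shape
  the rest. The free energies are infima in the extended reals and \<open>f\<close> is merely
  measurable, possibly unbounded on every interval, so finiteness at every mean and every positive
  variance requires densities concentrated where \<open>f\<close> is bounded. The derivative in
  \<open>\<tau>p\<close> is an envelope formula: near-minimizers may move with
  \<open>\<tau>p\<close>, and the lower bound, tested on the second moment, limits what such a move
  can gain. Finally, the variance is not linear in the density; convexity and perturbation arguments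
  therefore use second moments about a fixed point, and the square of the mean shift has to be
  corrected for afterwards.\<close>

definition prob_dens2 :: "(real \<Rightarrow> real) \<Rightarrow> bool" where
  "prob_dens2 b \<longleftrightarrow> b \<in> borel_measurable borel \<and> (\<forall>u. 0 \<le> b u) \<and> integrable lborel b \<and>
     (LINT u|lborel. b u) = 1 \<and> integrable lborel (\<lambda>u. u\<^sup>2 * b u)"

text \<open>Isolates the half of admissibility in which the potential does not occur; every moment
  identity below depends on that half alone.\<close>

lemma dens_adm_iff:
  "dens_adm f b \<longleftrightarrow> prob_dens2 b \<and> integrable lborel (\<lambda>u. b u * ln (b u) + b u * f u)"
  unfolding dens_adm_def prob_dens2_def by (auto simp: )

lemma prob_dens2_integrable_quad:
  assumes b: "prob_dens2 b" and h: "h \<in> borel_measurable borel"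
    and bd: "\<And>u. \<bar>h u\<bar> \<le> C * (1 + u\<^sup>2)"
  shows "integrable lborel (\<lambda>u. h u * b u)"
proof (rule Bochner_Integration.integrable_bound)
  show "integrable lborel (\<lambda>u. C * b u + C * (u\<^sup>2 * b u))"
    using b by (auto simp: prob_dens2_def)
  show "(\<lambda>u. h u * b u) \<in> borel_measurable lborel"
    using b h by (auto simp: prob_dens2_def)
  show "AE u in lborel. norm (h u * b u) \<le> norm (C * b u + C * (u\<^sup>2 * b u))"
  proof (rule AE_I2)
    fix u
    have "0 \<le> b u" using b by (auto simp: prob_dens2_def)
    then have "\<bar>h u * b u\<bar> \<le> C * (1 + u\<^sup>2) * b u"
      using bd[of u] by (simp add: abs_mult mult_right_mono)
    then show "norm (h u * b u) \<le> norm (C * b u + C * (u\<^sup>2 * b u))"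
      by (simp add: algebra_simps)
  qed
qed

lemma abs_le_one_plus_sq: "\<bar>u\<bar> \<le> 1 + (u::real)\<^sup>2"
proof -
  have "0 \<le> (\<bar>u\<bar> - 1)\<^sup>2" by simp
  then have "2 * \<bar>u\<bar> \<le> 1 + u\<^sup>2" by (simp add: power2_diff)
  then show ?thesis by (smt (verit) abs_ge_zero)
qed

text \<open>The three monomials are integrable separately, so the integral is linear in the
  coefficients; the variance identity is the instance that expands the square about
  \<open>dmean b\<close>. Later steps write their quadratics literally as
  \<open>a0 + a1 * u + a2 * u\<^sup>2\<close> in order to match.\<close>

lemma
  assumes b: "prob_dens2 b"
  shows prob_dens2_integrable_mean: "integrable lborel (\<lambda>u. u * b u)"
    and prob_dens2_integrable_poly: "integrable lborel (\<lambda>u. (a0 + a1 * u + a2 * u\<^sup>2) * b u)"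
    and prob_dens2_second_moment: "(LINT u|lborel. u\<^sup>2 * b u) = dvar b + (dmean b)\<^sup>2"
    and prob_dens2_poly_moment:
      "(LINT u|lborel. (a0 + a1 * u + a2 * u\<^sup>2) * b u) = a0 + a1 * dmean b + a2 * (dvar b + (dmean b)\<^sup>2)"
proof -
  show i1: "integrable lborel (\<lambda>u. u * b u)"
    by (rule prob_dens2_integrable_quad[OF b, where C = 1]) (use abs_le_one_plus_sq in auto)
  have i0: "integrable lborel b" "(LINT u|lborel. b u) = 1" "integrable lborel (\<lambda>u. u\<^sup>2 * b u)"
    using b by (auto simp: prob_dens2_def)
  have e: "(\<lambda>u. (a0 + a1 * u + a2 * u\<^sup>2) * b u) =
     (\<lambda>u. a0 * b u + a1 * (u * b u) + a2 * (u\<^sup>2 * b u))" for a0 a1 a2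
    by (auto simp: algebra_simps)
  show "integrable lborel (\<lambda>u. (a0 + a1 * u + a2 * u\<^sup>2) * b u)"
    unfolding e using i0 i1 by auto
  have mom: "(LINT u|lborel. (a0 + a1 * u + a2 * u\<^sup>2) * b u) =
      a0 + a1 * dmean b + a2 * (LINT u|lborel. u\<^sup>2 * b u)" for a0 a1 a2
    unfolding e dmean_def using i0 i1 by simp
  have "dvar b = (LINT u|lborel. ((dmean b)\<^sup>2 + (- 2 * dmean b) * u + 1 * u\<^sup>2) * b u)"
    unfolding dvar_def by (simp add: power2_diff algebra_simps)
  also have "\<dots> = (LINT u|lborel. u\<^sup>2 * b u) - (dmean b)\<^sup>2"
    unfolding mom by (simp add: power2_eq_square)
  finally show "(LINT u|lborel. u\<^sup>2 * b u) = dvar b + (dmean b)\<^sup>2" by simp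
  then show "(LINT u|lborel. (a0 + a1 * u + a2 * u\<^sup>2) * b u) = a0 + a1 * dmean b + a2 * (dvar b + (dmean b)\<^sup>2)"
    using mom by simp
qed

lemma prob_dens2_sq_moment:
  assumes b: "prob_dens2 b"
  shows "integrable lborel (\<lambda>u. (u - r)\<^sup>2 * b u)"
    and "(LINT u|lborel. (u - r)\<^sup>2 * b u) = dvar b + (dmean b - r)\<^sup>2"
proof -
  have e: "(u - r)\<^sup>2 = r\<^sup>2 + (- 2 * r) * u + 1 * u\<^sup>2" for u
    by (simp add: power2_diff)
  show "integrable lborel (\<lambda>u. (u - r)\<^sup>2 * b u)"
    unfolding e by (rule prob_dens2_integrable_poly[OF b])
  show "(LINT u|lborel. (u - r)\<^sup>2 * b u) = dvar b + (dmean b - r)\<^sup>2"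
    unfolding e prob_dens2_poly_moment[OF b] by (simp add: power2_diff)
qed

section \<open>Positivity of integrals and elementary inequalities for ln and exp\<close>

lemma integral_pos_lborel:
  fixes g :: "real \<Rightarrow> real"
  assumes "integrable lborel g" "\<And>u. 0 < g u"
  shows "0 < (LINT u|lborel. g u)"
proof -
  have "0 \<le> (LINT u|lborel. g u)" using assms(2) by (intro integral_nonneg_AE AE_I2 less_imp_le)
  moreover have "(LINT u|lborel. g u) \<noteq> 0"
  proof
    assume "(LINT u|lborel. g u) = 0"
    then have "AE u in lborel. g u = 0"
      using integral_nonneg_eq_0_iff_AE[OF assms(1)] assms(2) by (simp add: less_imp_le)
    then have "AE u in (lborel::real measure). False"
      by eventually_elim (use assms(2) in \<open>auto simp: less_le\<close>)
    then have "emeasure lborel (UNIV :: real set) = 0"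
      by (simp add: AE_iff_null null_sets_def)
    then show False by simp
  qed
  ultimately show ?thesis by simp
qed

text \<open>The set where \<open>q\<close> differs from 0 is open, and a nonempty open set is never
  negligible.\<close>

lemma AE_lborel_continuous_eq_0:
  fixes q :: "real \<Rightarrow> real"
  assumes "continuous_on UNIV q" "AE u in lborel. q u = 0"
  shows "q u = 0"
proof -
  have op: "open {u. q u \<noteq> 0}"
    using assms(1) by (intro open_Collect_neq) auto
  have "{u. q u \<noteq> 0} \<in> null_sets lborel"
    using assms(2) op AE_iff_null_sets[of "{u. q u \<noteq> 0}" lborel] by auto
  then have "negligible {u. q u \<noteq> 0}"
    by (simp add: negligible_iff_null_sets null_sets_completionI)
  then show ?thesis using open_not_negligible[OF op] by auto
qed

text \<open>For positive \<open>a\<close> this is ln y \<le> y - 1 at y = c / a, multiplied by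
  \<open>a\<close>, together with its equality case. At \<open>a = 0\<close> the factor in front
  removes the logarithm, and equality would force \<open>c = 0\<close>.\<close>

lemma relative_entropy_pointwise:
  fixes a c :: real
  assumes "0 \<le> a" "0 < c"
  shows "a - c \<le> a * (ln a - ln c)" and "a * (ln a - ln c) = a - c \<Longrightarrow> a = c"
proof -
  consider "a = 0" | "0 < a" using assms by linarith
  then have "a - c \<le> a * (ln a - ln c) \<and> (a * (ln a - ln c) = a - c \<longrightarrow> a = c)"
  proof cases
    case 2
    have e: "a * (ln a - ln c) = - (a * ln (c / a))" using 2 assms by (simp add: ln_div right_diff_distrib)
    have "ln (c / a) \<le> c / a - 1" using 2 assms by (intro ln_le_minus_one) auto
    then have "a * ln (c / a) \<le> a * (c / a - 1)" using 2 by (intro mult_left_mono) auto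
    then have "a - c \<le> a * (ln a - ln c)" unfolding e using 2 by (simp add: algebra_simps)
    moreover have "a = c" if "a * (ln a - ln c) = a - c"
    proof -
      have "a * ln (c / a) = a * (c / a - 1)" using that e 2 by (simp add: algebra_simps)
      then have "ln (c / a) = c / a - 1" using 2 by simp
      then show ?thesis using ln_eq_minus_one[of "c / a"] 2 assms by simp
    qed
    ultimately show ?thesis by simp
  qed (use assms in auto)
  then show "a - c \<le> a * (ln a - ln c)" "a * (ln a - ln c) = a - c \<Longrightarrow> a = c" by auto
qed

text \<open>From (1 - a) exp a \<le> 1 one gets exp a - 1 \<le> a exp a = a + a (exp a - 1), and the
  last product is of second order for either sign of \<open>a\<close>. The absolute value in the
  exponent allows tilts of both signs to share one dominating function.\<close>

lemma exp_le_quadratic: "exp (a::real) \<le> 1 + a + a\<^sup>2 * exp \<bar>a\<bar>"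
proof -
  have "(1 - a) * exp a \<le> exp (- a) * exp a"
    using exp_ge_add_one_self[of "- a"] by (intro mult_right_mono) auto
  then have 1: "exp a - 1 \<le> a * exp a" by (simp add: exp_minus algebra_simps)
  show ?thesis
  proof (cases "0 \<le> a")
    case True
    then have "a * (exp a - 1) \<le> a * (a * exp a)" using 1 by (intro mult_left_mono) auto
    then show ?thesis using 1 True by (simp add: algebra_simps power2_eq_square)
  next
    case False
    then have "a * (exp a - 1) \<le> a * a"
      using exp_ge_add_one_self[of a] by (intro mult_left_mono_neg) linarith+
    also have "\<dots> \<le> a\<^sup>2 * exp \<bar>a\<bar>"
      using False by (simp add: power2_eq_square mult_le_cancel_left1)
    finally show ?thesis using 1 by (simp add: algebra_simps)
  qed
qed

section \<open>Relative entropy with respect to a Gibbs density\<close>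

context
  fixes f :: "real \<Rightarrow> real" and r \<tau> :: real
  assumes ok: "potential_ok f" and tau: "0 < \<tau>"
begin

lemma gibbs_Z_pos: "0 < gibbs_Z f r \<tau>"
  unfolding gibbs_Z_def using ok tau by (intro integral_pos_lborel) (auto simp: potential_ok_def)

lemma gibbs_pos: "0 < gibbs f r \<tau> u"
  unfolding gibbs_def using gibbs_Z_pos by simp

lemma ln_gibbs: "ln (gibbs f r \<tau> u) = - f u - (u - r)\<^sup>2 / (2 * \<tau>) - ln (gibbs_Z f r \<tau>)"
  unfolding gibbs_def using gibbs_Z_pos by (simp add: ln_div)

lemma gibbs_prob_dens2: "prob_dens2 (gibbs f r \<tau>)"
proof -
  have f[measurable]: "f \<in> borel_measurable borel" using ok by (simp add: potential_ok_def)
  have g: "gibbs f r \<tau> = (\<lambda>u. exp (- f u - (u - r)\<^sup>2 / (2 * \<tau>)) / gibbs_Z f r \<tau>)"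
    by (auto simp: gibbs_def)
  have "gibbs f r \<tau> \<in> borel_measurable borel" unfolding g by measurable
  moreover have "integrable lborel (gibbs f r \<tau>)"
    unfolding g using ok tau by (intro integrable_divide) (auto simp: potential_ok_def)
  moreover have "(\<lambda>u. u\<^sup>2 * gibbs f r \<tau> u) = (\<lambda>u. u\<^sup>2 * exp (- f u - (u - r)\<^sup>2 / (2 * \<tau>)) / gibbs_Z f r \<tau>)"
    by (auto simp: gibbs_def)
  then have "integrable lborel (\<lambda>u. u\<^sup>2 * gibbs f r \<tau> u)"
    using ok tau by (auto simp: potential_ok_def)
  moreover have "(LINT u|lborel. gibbs f r \<tau> u) = 1"
    unfolding g integral_divide_zero gibbs_Z_def[symmetric] using gibbs_Z_pos by simp
  ultimately show ?thesis
    unfolding prob_dens2_def using gibbs_pos by (auto intro: less_imp_le)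
qed

text \<open>The weight is paid for by the Gaussian factor: what remains of it after absorbing the
  weight is the Gaussian factor of variance \<open>4 * \<tau>\<close>, for which
  \<open>potential_ok\<close> still grants integrability. The expression
  \<open>1 + 2 * u\<^sup>2\<close> is chosen to dominate
  \<open>\<alpha> * u + \<beta> * u\<^sup>2\<close> with coefficients bounded by 1.\<close>

lemma gibbs_exp_moment:
  "integrable lborel (\<lambda>u. ((1 + 2 * u\<^sup>2)\<^sup>2 * exp ((1 + 2 * u\<^sup>2) / (32 * \<tau>))) * gibbs f r \<tau> u)"
proof (rule Bochner_Integration.integrable_bound)
  \<comment> \<open>In \<open>?C\<close>, the factor \<open>2 / ?d\<^sup>2\<close> converts the
    squared weight into an exponential, \<open>exp (2 * ?d)\<close> collects the constant part of
    the two exponentials, and the factor with \<open>r\<close> comes from recentring the Gaussian at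
    0.\<close>
  let ?d = "1 / (32 * \<tau>)"
  let ?C = "2 / ?d\<^sup>2 * exp (2 * ?d) * exp (r\<^sup>2 / (2 * \<tau>)) / gibbs_Z f r \<tau>"
  have d: "0 < ?d" using tau by simp
  show "integrable lborel (\<lambda>u. ?C * exp (- f u - (u - 0)\<^sup>2 / (2 * (4 * \<tau>))))"
  proof (rule integrable_mult_right)
    have "0 < 4 * \<tau>" using tau by simp
    then show "integrable lborel (\<lambda>u. exp (- f u - (u - 0)\<^sup>2 / (2 * (4 * \<tau>))))"
      using ok unfolding potential_ok_def by blast
  qed
  show "(\<lambda>u. ((1 + 2 * u\<^sup>2)\<^sup>2 * exp ((1 + 2 * u\<^sup>2) / (32 * \<tau>))) * gibbs f r \<tau> u) \<in> borel_measurable lborel"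
    using gibbs_prob_dens2 by (auto simp: prob_dens2_def)
  show "AE u in lborel. norm (((1 + 2 * u\<^sup>2)\<^sup>2 * exp ((1 + 2 * u\<^sup>2) / (32 * \<tau>))) * gibbs f r \<tau> u)
    \<le> norm (?C * exp (- f u - (u - 0)\<^sup>2 / (2 * (4 * \<tau>))))"
  proof (rule AE_I2)
    fix u :: real
    let ?y = "1 + 2 * u\<^sup>2"
    have y: "0 \<le> ?d * ?y" using d by simp
    have "(?d * ?y)\<^sup>2 / 2 \<le> exp (?d * ?y)" using exp_lower_Taylor_quadratic[OF y] y by linarith
    then have y2: "?y\<^sup>2 \<le> 2 / ?d\<^sup>2 * exp (?d * ?y)"
    proof -
      have "?d\<^sup>2 * ?y\<^sup>2 \<le> 2 * exp (?d * ?y)"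
        using \<open>(?d * ?y)\<^sup>2 / 2 \<le> exp (?d * ?y)\<close> unfolding power_mult_distrib by linarith
      moreover have "0 < ?d\<^sup>2" using d by (rule zero_less_power)
      ultimately show ?thesis by (simp only: pos_le_divide_eq times_divide_eq_left mult.commute)
    qed
    \<comment> \<open>Half of the quadratic is given up to move the centre from \<open>r\<close> to
      0.\<close>
    have "(u - r)\<^sup>2 \<ge> u\<^sup>2 / 2 - r\<^sup>2"
      using zero_le_power2[of "u - 2 * r"] by (simp add: power2_eq_square field_simps)
    then have "- ((u - r)\<^sup>2 / (2 * \<tau>)) \<le> - ((u\<^sup>2 / 2 - r\<^sup>2) / (2 * \<tau>))"
      using tau by (simp add: divide_right_mono)
    also have "\<dots> = r\<^sup>2 / (2 * \<tau>) - u\<^sup>2 / (4 * \<tau>)"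
      using tau by (simp add: field_simps)
    finally have e2: "- ((u - r)\<^sup>2 / (2 * \<tau>)) \<le> r\<^sup>2 / (2 * \<tau>) - u\<^sup>2 / (4 * \<tau>)" .
    have "?y\<^sup>2 * exp (?d * ?y) * exp (- f u - (u - r)\<^sup>2 / (2 * \<tau>))
       \<le> (2 / ?d\<^sup>2 * exp (?d * ?y)) * exp (?d * ?y) * exp (- f u + (r\<^sup>2 / (2 * \<tau>) - u\<^sup>2 / (4 * \<tau>)))"
      using y2 e2 by (intro mult_mono mult_right_mono) auto
    also have "\<dots> = 2 / ?d\<^sup>2 * (exp (?d * ?y) * exp (?d * ?y) * exp (- f u + (r\<^sup>2 / (2 * \<tau>) - u\<^sup>2 / (4 * \<tau>))))"
      by (simp only: mult.assoc)
    also have "exp (?d * ?y) * exp (?d * ?y) * exp (- f u + (r\<^sup>2 / (2 * \<tau>) - u\<^sup>2 / (4 * \<tau>))) =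
       exp (2 * ?d) * exp (r\<^sup>2 / (2 * \<tau>)) * exp (- f u - (u - 0)\<^sup>2 / (2 * (4 * \<tau>)))"
    proof -
      \<comment> \<open>The two copies of \<open>?d * ?y\<close> use up
        \<open>u\<^sup>2 / (8 * \<tau>)\<close> of the available
        \<open>u\<^sup>2 / (4 * \<tau>)\<close>; the remaining half is the exponent of variance
        \<open>4 * \<tau>\<close>.\<close>
      have "?d * ?y + ?d * ?y + (- f u + (r\<^sup>2 / (2 * \<tau>) - u\<^sup>2 / (4 * \<tau>)))
        = 2 * ?d + r\<^sup>2 / (2 * \<tau>) + (- f u - (u - 0)\<^sup>2 / (2 * (4 * \<tau>)))"
        using tau by (simp add: add_divide_distrib)
      then show ?thesis unfolding exp_add[symmetric] by (rule arg_cong)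
    qed
    finally have "?y\<^sup>2 * exp (?d * ?y) * exp (- f u - (u - r)\<^sup>2 / (2 * \<tau>)) / gibbs_Z f r \<tau>
       \<le> 2 / ?d\<^sup>2 * (exp (2 * ?d) * exp (r\<^sup>2 / (2 * \<tau>)) * exp (- f u - (u - 0)\<^sup>2 / (2 * (4 * \<tau>)))) / gibbs_Z f r \<tau>"
      using gibbs_Z_pos by (intro divide_right_mono) auto
    also have "\<dots> \<le> \<bar>?C * exp (- f u - (u - 0)\<^sup>2 / (2 * (4 * \<tau>)))\<bar>" using gibbs_Z_pos by (simp add: mult.assoc abs_mult)
    finally show "norm (((1 + 2 * u\<^sup>2)\<^sup>2 * exp ((1 + 2 * u\<^sup>2) / (32 * \<tau>))) * gibbs f r \<tau> u)
      \<le> norm (?C * exp (- f u - (u - 0)\<^sup>2 / (2 * (4 * \<tau>))))"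
      using gibbs_Z_pos by (simp add: gibbs_def abs_mult)
  qed
qed

text \<open>Expressed through \<open>kl1\<close> and two moments instead of an integral, so that on
  densities with fixed moments it differs from \<open>kl1\<close> by a constant.\<close>

definition excess :: "(real \<Rightarrow> real) \<Rightarrow> real" where
  "excess b = kl1 f b + (dvar b + (dmean b - r)\<^sup>2) / (2 * \<tau>) + ln (gibbs_Z f r \<tau>)"

lemma excess_eq_integral:
  assumes "dens_adm f b"
  shows "integrable lborel (\<lambda>u. b u * (ln (b u) - ln (gibbs f r \<tau> u)))"
    and "excess b = (LINT u|lborel. b u * (ln (b u) - ln (gibbs f r \<tau> u)))"
proof -
  have b: "prob_dens2 b" and i: "integrable lborel (\<lambda>u. b u * ln (b u) + b u * f u)"
    using assms by (auto simp: dens_adm_iff)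
  have e: "(\<lambda>u. b u * (ln (b u) - ln (gibbs f r \<tau> u))) =
    (\<lambda>u. (b u * ln (b u) + b u * f u) + ((u - r)\<^sup>2 * b u) / (2 * \<tau>) + ln (gibbs_Z f r \<tau>) * b u)"
    by (auto simp: ln_gibbs algebra_simps)
  note s = prob_dens2_sq_moment[OF b, of r]
  show "integrable lborel (\<lambda>u. b u * (ln (b u) - ln (gibbs f r \<tau> u)))"
    unfolding e using b i s(1) by (auto simp: prob_dens2_def)
  show "excess b = (LINT u|lborel. b u * (ln (b u) - ln (gibbs f r \<tau> u)))"
    unfolding e excess_def kl1_def using b i s by (auto simp: prob_dens2_def)
qed

text \<open>The logarithm of the Gibbs density contains \<open>- f\<close>, which cancels the
  potential and leaves a quadratic integrated against the density.\<close>

lemma gibbs_adm: "dens_adm f (gibbs f r \<tau>)"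
proof -
  have "(\<lambda>u. gibbs f r \<tau> u * ln (gibbs f r \<tau> u) + gibbs f r \<tau> u * f u) =
    (\<lambda>u. - (((u - r)\<^sup>2 * gibbs f r \<tau> u) / (2 * \<tau>)) - ln (gibbs_Z f r \<tau>) * gibbs f r \<tau> u)"
    by (auto simp: ln_gibbs algebra_simps)
  then show ?thesis
    using gibbs_prob_dens2 prob_dens2_sq_moment(1)[OF gibbs_prob_dens2, of r]
    unfolding dens_adm_iff by (auto simp: prob_dens2_def)
qed

lemma excess_gibbs: "excess (gibbs f r \<tau>) = 0"
  by (simp add: excess_eq_integral[OF gibbs_adm])

text \<open>Zero variance would make the continuous function u - mean vanish almost everywhere,
  hence at every point. The same fact keeps \<open>\<tau>x\<close> positive along the
  iteration.\<close>

lemma gibbs_dvar_pos: "0 < dvar (gibbs f r \<tau>)"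
proof -
  let ?g = "gibbs f r \<tau>"
  note s = prob_dens2_sq_moment[OF gibbs_prob_dens2, of "dmean ?g"]
  have "0 \<le> dvar ?g" unfolding dvar_def using gibbs_pos
    by (intro integral_nonneg_AE AE_I2 mult_nonneg_nonneg) (auto intro: less_imp_le)
  moreover have "dvar ?g \<noteq> 0"
  proof
    assume "dvar ?g = 0"
    then have "(LINT u|lborel. (u - dmean ?g)\<^sup>2 * ?g u) = 0" by (simp only: dvar_def)
    then have "AE u in lborel. (u - dmean ?g)\<^sup>2 * ?g u = 0"
      using integral_nonneg_eq_0_iff_AE[OF s(1)] gibbs_pos by (simp add: less_imp_le)
    then have "AE u in lborel. u - dmean ?g = 0"
      by eventually_elim (use gibbs_pos in \<open>auto simp: less_le\<close>)
    then have "(dmean ?g + 1) - dmean ?g = 0"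
      by (intro AE_lborel_continuous_eq_0) (auto intro: continuous_intros)
    then show False by simp
  qed
  ultimately show ?thesis by simp
qed


text \<open>A second-order Donsker--Varadhan bound: the relative entropy is tested against
  \<open>\<epsilon> (\<alpha> u + \<beta> u\<^sup>2)\<close> and the resulting exponential moment is expanded in \<open>\<epsilon>\<close>.\<close>

lemma excess_lower_bound:
  obtains K where "\<And>b \<alpha> \<beta> \<epsilon>. dens_adm f b \<Longrightarrow> \<bar>\<alpha>\<bar> \<le> 1 \<Longrightarrow> \<bar>\<beta>\<bar> \<le> 1 \<Longrightarrow> \<bar>\<epsilon>\<bar> \<le> 1 / (32 * \<tau>) \<Longrightarrow>
    \<epsilon> * (\<alpha> * (dmean b - dmean (gibbs f r \<tau>))
      + \<beta> * ((dvar b + (dmean b)\<^sup>2) - (dvar (gibbs f r \<tau>) + (dmean (gibbs f r \<tau>))\<^sup>2))) - \<epsilon>\<^sup>2 * K \<le> excess b"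
proof
  let ?g = "gibbs f r \<tau>"
  let ?d = "1 / (32 * \<tau>)"
  let ?y = "\<lambda>u. 1 + 2 * u\<^sup>2 :: real"
  \<comment> \<open>This constant depends on the Gibbs density alone, which makes the second-order
    remainder uniform in \<open>b\<close>, \<open>\<alpha>\<close>, \<open>\<beta>\<close> and
    \<open>\<epsilon>\<close>.\<close>
  let ?K = "LINT u|lborel. ((?y u)\<^sup>2 * exp (?y u / (32 * \<tau>))) * ?g u"
  fix b :: "real \<Rightarrow> real" and \<alpha> \<beta> \<epsilon> :: real
  assume b: "dens_adm f b" and ab: "\<bar>\<alpha>\<bar> \<le> 1" "\<bar>\<beta>\<bar> \<le> 1" and eps: "\<bar>\<epsilon>\<bar> \<le> ?d"
  have b2: "prob_dens2 b" and g2: "prob_dens2 ?g" using b gibbs_prob_dens2 by (auto simp: dens_adm_iff)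
  have gm[measurable]: "?g \<in> borel_measurable borel" using g2 by (simp add: prob_dens2_def)
  \<comment> \<open>The leading 0 is the constant coefficient, kept so that \<open>h\<close> folds
    into the general quadratic moment rules.\<close>
  define h where "h u = 0 + \<alpha> * u + \<beta> * u\<^sup>2" for u
  define G where "G u = ?g u * exp (\<epsilon> * h u)" for u
  have [measurable]: "h \<in> borel_measurable borel" unfolding h_def by measurable
  have [measurable]: "G \<in> borel_measurable borel" unfolding G_def by measurable
  have hy: "\<bar>h u\<bar> \<le> ?y u" for u
  proof -
    have "\<bar>h u\<bar> \<le> \<bar>\<alpha>\<bar> * \<bar>u\<bar> + \<bar>\<beta>\<bar> * u\<^sup>2"
      unfolding h_def by (rule order_trans[OF abs_triangle_ineq]) (simp add: abs_mult)
    also have "\<dots> \<le> 1 * (1 + u\<^sup>2) + 1 * u\<^sup>2"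
      using ab abs_le_one_plus_sq[of u] by (intro add_mono mult_mono) auto
    finally show ?thesis by simp
  qed
  have eh: "\<bar>\<epsilon> * h u\<bar> \<le> ?y u / (32 * \<tau>)" for u
  proof -
    have "\<bar>\<epsilon> * h u\<bar> \<le> ?d * ?y u" using eps hy[of u] tau unfolding abs_mult by (intro mult_mono) auto
    then show ?thesis by simp
  qed
  have G_pos: "0 < G u" for u unfolding G_def using gibbs_pos by simp
  have y1: "1 \<le> (?y u)\<^sup>2" for u by (intro one_le_power) simp
  have iK: "integrable lborel (\<lambda>u. ((?y u)\<^sup>2 * exp (?y u / (32 * \<tau>))) * ?g u)"
    by (rule gibbs_exp_moment)
  have iG: "integrable lborel G"
  proof (rule Bochner_Integration.integrable_bound[OF iK])
    show "AE u in lborel. norm (G u) \<le> norm (((?y u)\<^sup>2 * exp (?y u / (32 * \<tau>))) * ?g u)"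
    proof (rule AE_I2)
      fix u
      have "1 * exp (\<epsilon> * h u) \<le> (?y u)\<^sup>2 * exp (?y u / (32 * \<tau>))"
        using y1[of u] eh[of u] by (intro mult_mono) auto
      then have "exp (\<epsilon> * h u) * ?g u \<le> (?y u)\<^sup>2 * exp (?y u / (32 * \<tau>)) * ?g u"
        using gibbs_pos[of u] by (intro mult_right_mono) auto
      then show "norm (G u) \<le> norm (((?y u)\<^sup>2 * exp (?y u / (32 * \<tau>))) * ?g u)"
        using G_pos[of u] by (simp add: G_def mult.commute)
    qed
  qed simp
  note ih = prob_dens2_integrable_poly[OF _, of _ 0 \<alpha> \<beta>, folded h_def]
  note mh = prob_dens2_poly_moment[OF _, of _ 0 \<alpha> \<beta>, folded h_def]
  have "(LINT u|lborel. G u) \<le> (LINT u|lborel. ?g u + \<epsilon> * (h u * ?g u)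
      + \<epsilon>\<^sup>2 * (((?y u)\<^sup>2 * exp (?y u / (32 * \<tau>))) * ?g u))"
  proof (rule integral_mono[OF iG])
    show "integrable lborel (\<lambda>u. ?g u + \<epsilon> * (h u * ?g u)
      + \<epsilon>\<^sup>2 * (((?y u)\<^sup>2 * exp (?y u / (32 * \<tau>))) * ?g u))"
      using iK ih[OF g2] g2 by (auto simp: prob_dens2_def)
    fix u
    have "exp (\<epsilon> * h u) \<le> 1 + \<epsilon> * h u + (\<epsilon> * h u)\<^sup>2 * exp \<bar>\<epsilon> * h u\<bar>" by (rule exp_le_quadratic)
    also have "(\<epsilon> * h u)\<^sup>2 * exp \<bar>\<epsilon> * h u\<bar> \<le> (\<epsilon>\<^sup>2 * (?y u)\<^sup>2) * exp (?y u / (32 * \<tau>))"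
    proof (rule mult_mono)
      have "\<bar>h u\<bar>\<^sup>2 \<le> (?y u)\<^sup>2" using hy[of u] by (intro power_mono) auto
      then show "(\<epsilon> * h u)\<^sup>2 \<le> \<epsilon>\<^sup>2 * (?y u)\<^sup>2"
        unfolding power_mult_distrib by (intro mult_left_mono) simp_all
    qed (use eh[of u] in auto)
    finally have "exp (\<epsilon> * h u) * ?g u \<le> (1 + \<epsilon> * h u + (\<epsilon>\<^sup>2 * (?y u)\<^sup>2) * exp (?y u / (32 * \<tau>))) * ?g u"
      using gibbs_pos[of u] by (intro mult_right_mono) auto
    then show "G u \<le> ?g u + \<epsilon> * (h u * ?g u)
      + \<epsilon>\<^sup>2 * (((?y u)\<^sup>2 * exp (?y u / (32 * \<tau>))) * ?g u)"
      by (simp add: G_def algebra_simps)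
  qed
  also have "\<dots> = 1 + \<epsilon> * (LINT u|lborel. h u * ?g u) + \<epsilon>\<^sup>2 * ?K"
    using iK ih[OF g2] g2 by (simp add: prob_dens2_def)
  finally have N: "(LINT u|lborel. G u) \<le> 1 + \<epsilon> * (LINT u|lborel. h u * ?g u) + \<epsilon>\<^sup>2 * ?K" .
  \<comment> \<open>The tilt \<open>G\<close> stays unnormalized: the pointwise bound then gives 1 -
    \<integral>G in place of - ln \<integral>G, and the expansion of \<integral>G can be inserted
    directly.\<close>
  have "1 - (LINT u|lborel. G u) + \<epsilon> * (LINT u|lborel. h u * b u)
      = (LINT u|lborel. b u - G u + \<epsilon> * (h u * b u))"
    using iG ih[OF b2] b2 by (simp add: prob_dens2_def)
  also have "\<dots> \<le> (LINT u|lborel. b u * (ln (b u) - ln (?g u)))"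
  proof (rule integral_mono)
    show "integrable lborel (\<lambda>u. b u - G u + \<epsilon> * (h u * b u))"
      using iG ih[OF b2] b2 by (auto simp: prob_dens2_def)
    show "integrable lborel (\<lambda>u. b u * (ln (b u) - ln (?g u)))"
      by (rule excess_eq_integral(1)[OF b])
    fix u
    have "0 \<le> b u" using b2 by (simp add: prob_dens2_def)
    then have "b u - G u \<le> b u * (ln (b u) - ln (G u))"
      using G_pos by (intro relative_entropy_pointwise)
    also have "ln (G u) = ln (?g u) + \<epsilon> * h u"
      unfolding G_def using gibbs_pos[of u] by (simp add: ln_mult)
    finally show "b u - G u + \<epsilon> * (h u * b u) \<le> b u * (ln (b u) - ln (?g u))"
      by (simp add: algebra_simps)
  qed
  also have "\<dots> = excess b" by (simp add: excess_eq_integral(2)[OF b])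
  finally have "\<epsilon> * ((LINT u|lborel. h u * b u) - (LINT u|lborel. h u * ?g u)) - \<epsilon>\<^sup>2 * ?K \<le> excess b"
    using N by (simp add: algebra_simps)
  then show "\<epsilon> * (\<alpha> * (dmean b - dmean ?g)
      + \<beta> * ((dvar b + (dmean b)\<^sup>2) - (dvar ?g + (dmean ?g)\<^sup>2))) - \<epsilon>\<^sup>2 * ?K \<le> excess b"
    unfolding mh[OF b2] mh[OF g2] by (simp add: algebra_simps)
qed

text \<open>The tilted bound at \<epsilon> = 0 has left side 0.\<close>

lemma excess_nonneg: "dens_adm f b \<Longrightarrow> 0 \<le> excess b"
proof -
  assume b: "dens_adm f b"
  obtain K where "\<And>b \<alpha> \<beta> \<epsilon>. dens_adm f b \<Longrightarrow> \<bar>\<alpha>\<bar> \<le> 1 \<Longrightarrow> \<bar>\<beta>\<bar> \<le> 1 \<Longrightarrow> \<bar>\<epsilon>\<bar> \<le> 1 / (32 * \<tau>) \<Longrightarrow>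
    \<epsilon> * (\<alpha> * (dmean b - dmean (gibbs f r \<tau>))
      + \<beta> * ((dvar b + (dmean b)\<^sup>2) - (dvar (gibbs f r \<tau>) + (dmean (gibbs f r \<tau>))\<^sup>2))) - \<epsilon>\<^sup>2 * K \<le> excess b"
    by (rule excess_lower_bound) blast
  from this[OF b, of 0 0 0] show ?thesis using tau by simp
qed

text \<open>Since both densities have mass one, subtracting \<open>b - g\<close> under the integral
  changes nothing and makes the integrand nonnegative; zero excess then puts almost every point in
  the equality case.\<close>

lemma excess_eq_0_AE:
  assumes b: "dens_adm f b" and 0: "excess b = 0"
  shows "AE u in lborel. b u = gibbs f r \<tau> u"
proof -
  let ?g = "gibbs f r \<tau>"
  have b2: "prob_dens2 b" and g2: "prob_dens2 ?g" using b gibbs_prob_dens2 by (auto simp: dens_adm_iff)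
  note i = excess_eq_integral[OF b]
  have ge: "0 \<le> b u * (ln (b u) - ln (?g u)) - (b u - ?g u)" for u
    using relative_entropy_pointwise(1)[of "b u" "?g u"] gibbs_pos b2 by (simp add: prob_dens2_def)
  have ii: "integrable lborel (\<lambda>u. b u * (ln (b u) - ln (?g u)) - (b u - ?g u))"
    using i b2 g2 by (auto simp: prob_dens2_def)
  have "(LINT u|lborel. b u * (ln (b u) - ln (?g u)) - (b u - ?g u)) = 0"
    using i b2 g2 0 by (simp add: prob_dens2_def)
  then have "AE u in lborel. b u * (ln (b u) - ln (?g u)) - (b u - ?g u) = 0"
    using integral_nonneg_eq_0_iff_AE[OF ii] ge by auto
  then show ?thesis
  proof eventually_elim
    case (elim u)
    have "b u = ?g u"
      using elim relative_entropy_pointwise(2)[of "b u" "?g u"] gibbs_pos b2 by (simp add: prob_dens2_def)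
    then show ?case .
  qed
qed

end

section \<open>Moving the moments of a Gibbs density at quadratic cost\<close>

context
  fixes f :: "real \<Rightarrow> real" and r \<tau> :: real
  assumes ok: "potential_ok f" and tau: "0 < \<tau>"
begin

text \<open>Bounded perturbation directions that move one moment of the Gibbs density at a time. They are
  quadratics damped by \<open>1 / (1 + (u - m)\<^sup>2)\<close>; the required coefficients exist because the Gram
  matrix of \<open>1, u - m, (u - m)\<^sup>2\<close> is injective.\<close>

lemma gibbs_moment_direction:
  fixes y :: "real \<times> real \<times> real"
  defines "g \<equiv> gibbs f r \<tau>"
  defines "m \<equiv> dmean g"
  obtains h B where "h \<in> borel_measurable borel" "\<And>u. \<bar>h u\<bar> \<le> B"
    "(LINT u|lborel. h u * g u) = fst y"
    "(LINT u|lborel. (h u * (u - m)) * g u) = fst (snd y)"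
    "(LINT u|lborel. (h u * (u - m)\<^sup>2) * g u) = snd (snd y)"
proof -
  have g2: "prob_dens2 g" unfolding g_def by (rule gibbs_prob_dens2[OF ok tau])
  have g_pos: "0 < g u" for u unfolding g_def by (rule gibbs_pos[OF ok tau])
  \<comment> \<open>Exponents 0, 1, 2 give bounded functions, from which the direction is built.
    Testing it against powers up to 2 raises the exponent to at most 4, where the growth is still
    quadratic.\<close>
  define w where "w k u = (u - m) ^ k / (1 + (u - m)\<^sup>2)" for k u
  define I where "I k = (LINT u|lborel. w k u * g u)" for k
  have den: "0 < 1 + (u - m)\<^sup>2" for u by (simp add: add_pos_nonneg)
  have wm[measurable]: "w k \<in> borel_measurable borel" for k unfolding w_def by measurable
  have wb: "\<bar>w k u\<bar> \<le> 1" if "k \<le> 2" for k u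
  proof -
    have "k = 0 \<or> k = 1 \<or> k = 2" using that by linarith
    then have "\<bar>(u - m) ^ k\<bar> \<le> 1 + (u - m)\<^sup>2" using abs_le_one_plus_sq[of "u - m"] by auto
    then show ?thesis unfolding w_def using den[of u] by (simp add: abs_divide)
  qed
  have sh: "(u - m)\<^sup>2 \<le> (2 + 2 * m\<^sup>2) * (1 + u\<^sup>2)" for u
  proof -
    have "(u - m)\<^sup>2 \<le> 2 * u\<^sup>2 + 2 * m\<^sup>2"
      using zero_le_power2[of "u + m"] by (simp add: power2_eq_square algebra_simps)
    also have "\<dots> \<le> (2 + 2 * m\<^sup>2) * (1 + u\<^sup>2)" by (simp add: algebra_simps)
    finally show ?thesis .
  qed
  have wi: "integrable lborel (\<lambda>u. w k u * g u)" if "k \<le> 4" for k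
  proof (rule prob_dens2_integrable_quad[OF g2 wm, where C = "3 + 2 * m\<^sup>2"])
    fix u
    have "\<bar>w k u\<bar> \<le> 1 + (u - m)\<^sup>2"
    proof (cases "k \<le> 2")
      case True
      then show ?thesis using wb[OF True, of u] by (smt (verit) zero_le_power2)
    next
      case False
      then have k: "k = (k - 2) + 2" by simp
      have "\<bar>w k u\<bar> = \<bar>w (k - 2) u\<bar> * (u - m)\<^sup>2"
        by (subst k, subst w_def, subst power_add) (simp add: w_def abs_mult)
      also have "\<dots> \<le> 1 * (u - m)\<^sup>2" using wb[of "k - 2" u] that by (intro mult_right_mono) auto
      finally show ?thesis by simp
    qed
    also have "\<dots> \<le> (1 + u\<^sup>2) + (2 + 2 * m\<^sup>2) * (1 + u\<^sup>2)" using sh[of u] zero_le_power2[of u] by linarith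
    also have "\<dots> = (3 + 2 * m\<^sup>2) * (1 + u\<^sup>2)" by (simp add: algebra_simps)
    finally show "\<bar>w k u\<bar> \<le> (3 + 2 * m\<^sup>2) * (1 + u\<^sup>2)" .
  qed
  define H where "H a u = fst a * w 0 u + fst (snd a) * w 1 u + snd (snd a) * w 2 u" for a :: "real \<times> real \<times> real" and u
  have Hm[measurable]: "H a \<in> borel_measurable borel" for a unfolding H_def by measurable
  have wk: "w k u * (u - m) ^ l = w (k + l) u" for k l u unfolding w_def by (simp add: power_add)
  have Hk: "(H a u * (u - m) ^ k) * g u = fst a * (w k u * g u) + fst (snd a) * (w (k + 1) u * g u)
      + snd (snd a) * (w (k + 2) u * g u)" for a u k
    unfolding H_def using wk[of 0 u k] wk[of 1 u k] wk[of 2 u k] by (simp add: algebra_simps)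
  have Hint: "integrable lborel (\<lambda>u. (H a u * (u - m) ^ k) * g u)"
    and HI: "(LINT u|lborel. (H a u * (u - m) ^ k) * g u) = fst a * I k + fst (snd a) * I (k + 1) + snd (snd a) * I (k + 2)"
    if "k \<le> 2" for a k
  proof -
    have i: "integrable lborel (\<lambda>u. w k u * g u)" "integrable lborel (\<lambda>u. w (k + 1) u * g u)"
      "integrable lborel (\<lambda>u. w (k + 2) u * g u)" using that by (auto intro!: wi)
    show "integrable lborel (\<lambda>u. (H a u * (u - m) ^ k) * g u)"
      unfolding Hk using i by (intro Bochner_Integration.integrable_add integrable_mult_right)
    show "(LINT u|lborel. (H a u * (u - m) ^ k) * g u) = fst a * I k + fst (snd a) * I (k + 1) + snd (snd a) * I (k + 2)"
      unfolding Hk I_def using i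
      by (simp only: Bochner_Integration.integral_add Bochner_Integration.integrable_add
          integrable_mult_right integral_mult_right_zero)
  qed
  \<comment> \<open>The entries depend only on the sum of the two indices because \<open>w k\<close>
    times \<open>(u - m) ^ l\<close> is \<open>w (k + l)\<close>. On a three-dimensional space
    injectivity already gives solvability for every \<open>y\<close>.\<close>
  define M where "M a = (fst a * I 0 + fst (snd a) * I 1 + snd (snd a) * I 2,
      fst a * I 1 + fst (snd a) * I 2 + snd (snd a) * I 3,
      fst a * I 2 + fst (snd a) * I 3 + snd (snd a) * I 4)" for a :: "real \<times> real \<times> real"
  have lin: "linear M" by (intro linearI) (auto simp: M_def algebra_simps)
  have "inj M"
  proof (subst linear_injective_0[OF lin], intro allI impI)
    fix a assume "M a = 0"
    then have z: "(LINT u|lborel. (H a u * (u - m) ^ k) * g u) = 0" if "k \<le> 2" for k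
    proof -
      have "k = 0 \<or> k = 1 \<or> k = 2" using that by linarith
      then show ?thesis using \<open>M a = 0\<close> HI[OF that, of a]
        by (auto simp: M_def zero_prod_def numeral_3_eq_3 numeral_2_eq_2 eval_nat_numeral)
    qed
    \<comment> \<open>Pairing \<open>H a\<close> with the undamped quadratic combines the three
      vanishing moments, yet equals the integral of \<open>?q\<close> squared over
      \<open>1 + (u - m)\<^sup>2\<close> against a positive density.\<close>
    let ?q = "\<lambda>u. fst a + fst (snd a) * (u - m) + snd (snd a) * (u - m)\<^sup>2"
    have Hq: "H a u * (1 + (u - m)\<^sup>2) = ?q u" for u
    proof -
      have "w k u * (1 + (u - m)\<^sup>2) = (u - m) ^ k" for k unfolding w_def using den[of u] by simp
      note this[of 0] this[of 1] this[of 2]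
      then show ?thesis unfolding H_def distrib_right mult.assoc by simp
    qed
    have e: "(H a u * ?q u) * g u = fst a * ((H a u * (u - m) ^ 0) * g u)
      + fst (snd a) * ((H a u * (u - m) ^ 1) * g u) + snd (snd a) * ((H a u * (u - m) ^ 2) * g u)" for u
      by (simp add: algebra_simps)
    have i: "integrable lborel (\<lambda>u. (H a u * ?q u) * g u)"
      unfolding e by (intro Bochner_Integration.integrable_add integrable_mult_right Hint) auto
    have zero: "(LINT u|lborel. (H a u * ?q u) * g u) = 0"
      unfolding e using Hint[of 0 a] Hint[of 1 a] Hint[of 2 a] z[of 0] z[of 1] z[of 2]
      by (simp del: power_0 power_one_right power_Suc0_right)
    have sq: "(H a u * ?q u) * g u = (?q u)\<^sup>2 * g u / (1 + (u - m)\<^sup>2)" for u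
      unfolding Hq[of u, symmetric] using den[of u] by (simp add: power2_eq_square)
    have nn: "0 \<le> (H a u * ?q u) * g u" for u
      unfolding sq using g_pos[of u] den[of u] by (intro divide_nonneg_nonneg mult_nonneg_nonneg) auto
    have "AE u in lborel. (H a u * ?q u) * g u = 0"
      using integral_nonneg_eq_0_iff_AE[OF i] nn zero by auto
    then have ae: "AE u in lborel. ?q u = 0"
    proof eventually_elim
      case (elim u)
      then show ?case unfolding sq using g_pos[of u] den[of u] by auto
    qed
    have q0: "?q u = 0" for u
      by (rule AE_lborel_continuous_eq_0[OF _ ae]) (intro continuous_intros)
    \<comment> \<open>Three distinct zeros determine all three coefficients.\<close>
    from q0[of m] q0[of "m + 1"] q0[of "m - 1"] show "a = 0"
      by (auto simp: prod_eq_iff)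
  qed
  then have "surj M" using linear_injective_imp_surjective[OF lin] by simp
  then obtain a where a: "M a = y" by (metis surjD)
  show ?thesis
  proof
    show "H a \<in> borel_measurable borel" by simp
    fix u
    have "\<bar>H a u\<bar> \<le> \<bar>fst a\<bar> * \<bar>w 0 u\<bar> + \<bar>fst (snd a)\<bar> * \<bar>w 1 u\<bar> + \<bar>snd (snd a)\<bar> * \<bar>w 2 u\<bar>"
      unfolding H_def abs_mult[symmetric] by linarith
    also have "\<dots> \<le> \<bar>fst a\<bar> * 1 + \<bar>fst (snd a)\<bar> * 1 + \<bar>snd (snd a)\<bar> * 1"
      by (intro add_mono mult_left_mono wb) auto
    finally show "\<bar>H a u\<bar> \<le> \<bar>fst a\<bar> + \<bar>fst (snd a)\<bar> + \<bar>snd (snd a)\<bar>" by simp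
  next
    show "(LINT u|lborel. H a u * g u) = fst y" "(LINT u|lborel. (H a u * (u - m)) * g u) = fst (snd y)"
      "(LINT u|lborel. (H a u * (u - m)\<^sup>2) * g u) = snd (snd y)"
      using HI[of 0 a] HI[of 1 a] HI[of 2 a] unfolding a[symmetric] by (auto simp: M_def eval_nat_numeral)
  qed
qed

text \<open>The excess of \<open>g (1 + h)\<close> with \<open>\<integral> g h = 0\<close> is at most \<open>\<integral> g h\<^sup>2\<close>, since
  \<open>ln (1 + h) \<le> h\<close>.\<close>

lemma gibbs_perturbation:
  fixes h :: "real \<Rightarrow> real"
  defines "g \<equiv> gibbs f r \<tau>"
  defines "m \<equiv> dmean g"
  assumes hm[measurable]: "h \<in> borel_measurable borel" and hb: "\<And>u. \<bar>h u\<bar> \<le> B" and B: "B \<le> 1 / 2"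
    and h0: "(LINT u|lborel. h u * g u) = 0"
    and h1: "(LINT u|lborel. (h u * (u - m)) * g u) = d"
    and h2: "(LINT u|lborel. (h u * (u - m)\<^sup>2) * g u) = e"
  defines "b \<equiv> (\<lambda>u. g u * (1 + h u))"
  shows "dens_adm f b" "dmean b = m + d" "dvar b = dvar g + e - d\<^sup>2" "excess f r \<tau> b \<le> B\<^sup>2"
proof -
  have g2: "prob_dens2 g" unfolding g_def by (rule gibbs_prob_dens2[OF ok tau])
  have g_pos: "0 < g u" for u unfolding g_def by (rule gibbs_pos[OF ok tau])
  have [measurable]: "g \<in> borel_measurable borel" using g2 by (simp add: prob_dens2_def)
  \<comment> \<open>This keeps \<open>b\<close> between half of \<open>g\<close> and three halves of
    \<open>g\<close>, which secures positivity, the second moment and a bounded logarithm of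
    \<open>1 + h\<close>.\<close>
  have hh: "- (1 / 2) \<le> h u" "h u \<le> 1 / 2" for u using hb[of u] B by linarith+
  have gi: "integrable lborel g" "(LINT u|lborel. g u) = 1" using g2 by (auto simp: prob_dens2_def)
  have hi: "integrable lborel (\<lambda>u. h u * g u)"
  proof (rule prob_dens2_integrable_quad[OF g2 hm, where C = 1])
    fix u
    have "\<bar>h u\<bar> \<le> 1" using hh[of u] by linarith
    then show "\<bar>h u\<bar> \<le> 1 * (1 + u\<^sup>2)" by (smt (verit) zero_le_power2 mult_1)
  qed
  have hi1: "integrable lborel (\<lambda>u. (h u * (u - m)) * g u)"
  proof (rule prob_dens2_integrable_quad[OF g2, where C = "1 + \<bar>m\<bar>"])
    fix u
    have "\<bar>h u * (u - m)\<bar> \<le> 1 * (\<bar>u\<bar> + \<bar>m\<bar>)"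
      unfolding abs_mult using hh[of u] by (intro mult_mono) auto
    also have "\<dots> \<le> 1 * (1 + u\<^sup>2) + \<bar>m\<bar> * (1 + u\<^sup>2)"
      using abs_le_one_plus_sq[of u] mult_left_mono[of 1 "1 + u\<^sup>2" "\<bar>m\<bar>"] by simp
    also have "\<dots> = (1 + \<bar>m\<bar>) * (1 + u\<^sup>2)" by (rule distrib_right[symmetric])
    finally show "\<bar>h u * (u - m)\<bar> \<le> (1 + \<bar>m\<bar>) * (1 + u\<^sup>2)" .
  qed simp
  have hi2: "integrable lborel (\<lambda>u. (h u * (u - m)\<^sup>2) * g u)"
  proof (rule Bochner_Integration.integrable_bound[OF prob_dens2_sq_moment(1)[OF g2, of m]])
    show "AE u in lborel. norm ((h u * (u - m)\<^sup>2) * g u) \<le> norm ((u - m)\<^sup>2 * g u)"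
    proof (rule AE_I2)
      fix u
      have "\<bar>h u\<bar> * ((u - m)\<^sup>2 * g u) \<le> 1 * ((u - m)\<^sup>2 * g u)"
        using hh[of u] g_pos[of u] by (intro mult_right_mono mult_nonneg_nonneg) auto
      then show "norm ((h u * (u - m)\<^sup>2) * g u) \<le> norm ((u - m)\<^sup>2 * g u)"
        using g_pos[of u] by (simp add: abs_mult)
    qed
  qed simp
  have be: "b u = g u + h u * g u" for u unfolding b_def by (simp add: algebra_simps)
  have b_pos: "0 < b u" for u unfolding b_def using g_pos[of u] hh[of u] by (intro mult_pos_pos) auto
  have [measurable]: "b \<in> borel_measurable borel" unfolding b_def by measurable
  have bg: "b u \<le> 2 * g u" for u
    unfolding b_def using g_pos[of u] hh[of u] mult_left_mono[of "1 + h u" 2 "g u"] by simp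
  have b2: "prob_dens2 b"
    unfolding prob_dens2_def
  proof (intro conjI allI)
    show "0 \<le> b u" for u using b_pos by (simp add: less_imp_le)
    show "integrable lborel b" "(LINT u|lborel. b u) = 1" unfolding be using gi hi h0 by auto
    show "integrable lborel (\<lambda>u. u\<^sup>2 * b u)"
    proof (rule Bochner_Integration.integrable_bound)
      show "integrable lborel (\<lambda>u. 2 * (u\<^sup>2 * g u))" using g2 by (auto simp: prob_dens2_def)
      show "AE u in lborel. norm (u\<^sup>2 * b u) \<le> norm (2 * (u\<^sup>2 * g u))"
      proof (rule AE_I2)
        fix u
        have "u\<^sup>2 * b u \<le> u\<^sup>2 * (2 * g u)" using bg by (intro mult_left_mono) auto
        then show "norm (u\<^sup>2 * b u) \<le> norm (2 * (u\<^sup>2 * g u))"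
          using b_pos[of u] g_pos[of u] by (simp add: abs_mult)
      qed
    qed simp
  qed simp
  have "(LINT u|lborel. (- m + 1 * u + 0 * u\<^sup>2) * b u)
     = (LINT u|lborel. (- m + 1 * u + 0 * u\<^sup>2) * g u + (h u * (u - m)) * g u)"
    unfolding be by (intro Bochner_Integration.integral_cong) (auto simp: algebra_simps)
  also have "\<dots> = (LINT u|lborel. (- m + 1 * u + 0 * u\<^sup>2) * g u) + d"
    by (subst Bochner_Integration.integral_add[OF prob_dens2_integrable_poly[OF g2] hi1]) (simp add: h1)
  finally show mean: "dmean b = m + d"
    unfolding prob_dens2_poly_moment[OF b2] prob_dens2_poly_moment[OF g2] by (simp add: m_def)
  \<comment> \<open>About the old mean the second moment changes linearly in \<open>h\<close>;
    referring it to the new mean subtracts the square of the shift \<open>d\<close>.\<close>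
  have "(LINT u|lborel. (u - m)\<^sup>2 * b u) = (LINT u|lborel. (u - m)\<^sup>2 * g u + (h u * (u - m)\<^sup>2) * g u)"
    unfolding be by (intro Bochner_Integration.integral_cong) (auto simp: algebra_simps)
  also have "\<dots> = (LINT u|lborel. (u - m)\<^sup>2 * g u) + e"
    by (subst Bochner_Integration.integral_add[OF prob_dens2_sq_moment(1)[OF g2] hi2]) (simp add: h2)
  finally show "dvar b = dvar g + e - d\<^sup>2"
    unfolding prob_dens2_sq_moment(2)[OF b2] prob_dens2_sq_moment(2)[OF g2] mean by (simp add: m_def)
  have ln_b: "ln (b u) = ln (g u) + ln (1 + h u)" for u
    unfolding b_def using g_pos[of u] hh[of u] by (simp add: ln_mult)
  have ln_bd: "\<bar>(1 + h u) * ln (1 + h u)\<bar> \<le> 2 * (1 + u\<^sup>2)" for u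
  proof -
    have "ln (1 + h u) \<le> h u" using hh[of u] by (intro ln_add_one_self_le_self2) auto
    \<comment> \<open>Applying ln y \<le> y - 1 to the reciprocal bounds the logarithm from
      below.\<close>
    moreover have "- ln (1 + h u) \<le> 1 / (1 + h u) - 1"
      using ln_le_minus_one[of "1 / (1 + h u)"] hh[of u] by (simp add: ln_div)
    moreover have "1 / (1 + h u) \<le> 2" using hh[of u] by (simp add: divide_le_eq)
    ultimately have "\<bar>ln (1 + h u)\<bar> \<le> 1" using hh[of u] by linarith
    then have "\<bar>1 + h u\<bar> * \<bar>ln (1 + h u)\<bar> \<le> 2 * 1" using hh[of u] by (intro mult_mono) auto
    then show ?thesis by (simp add: abs_mult) (smt (verit) zero_le_power2)
  qed
  have li: "integrable lborel (\<lambda>u. ((1 + h u) * ln (1 + h u)) * g u)"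
    by (rule prob_dens2_integrable_quad[OF g2 _ ln_bd]) simp
  have ent: "b u * ln (b u) + b u * f u
      = ((1 + h u) * ln (1 + h u)) * g u - ((u - r)\<^sup>2 * b u) / (2 * \<tau>) - ln (gibbs_Z f r \<tau>) * b u" for u
  proof -
    have "ln (b u) = - f u - (u - r)\<^sup>2 / (2 * \<tau>) - ln (gibbs_Z f r \<tau>) + ln (1 + h u)"
      unfolding ln_b g_def ln_gibbs[OF ok tau] by simp
    then have "b u * ln (b u) + b u * f u
      = b u * ln (1 + h u) - ((u - r)\<^sup>2 * b u) / (2 * \<tau>) - ln (gibbs_Z f r \<tau>) * b u"
      by (simp only:) (simp add: algebra_simps)
    then show ?thesis by (simp add: b_def mult_ac)
  qed
  show adm: "dens_adm f b"
    unfolding dens_adm_iff ent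
    using b2 li prob_dens2_sq_moment(1)[OF b2, of r] by (auto simp: prob_dens2_def)
  have "excess f r \<tau> b = (LINT u|lborel. ((1 + h u) * ln (1 + h u)) * g u)"
    unfolding excess_eq_integral(2)[OF ok tau adm] g_def[symmetric] ln_b
    by (intro Bochner_Integration.integral_cong) (auto simp: b_def)
  also have "\<dots> \<le> (LINT u|lborel. h u * g u + B\<^sup>2 * g u)"
  proof (rule integral_mono[OF li])
    show "integrable lborel (\<lambda>u. h u * g u + B\<^sup>2 * g u)" using hi gi by auto
    fix u
    have "(1 + h u) * ln (1 + h u) \<le> (1 + h u) * h u"
      using hh[of u] by (intro mult_left_mono ln_add_one_self_le_self2) auto
    also have "\<dots> = h u + \<bar>h u\<bar>\<^sup>2" by (simp add: power2_eq_square algebra_simps)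
    also have "\<dots> \<le> h u + B\<^sup>2" using hb[of u] by (intro add_left_mono power_mono) auto
    finally have "((1 + h u) * ln (1 + h u)) * g u \<le> (h u + B\<^sup>2) * g u"
      using g_pos[of u] by (intro mult_right_mono) auto
    then show "((1 + h u) * ln (1 + h u)) * g u \<le> h u * g u + B\<^sup>2 * g u" by (simp add: algebra_simps)
  qed
  also have "\<dots> = B\<^sup>2" using hi gi h0 by simp
  finally show "excess f r \<tau> b \<le> B\<^sup>2" .
qed

lemma excess_upper_bound:
  obtains C \<delta> where "0 \<le> C" "0 < \<delta>"
    "\<And>d e. \<bar>d\<bar> \<le> \<delta> \<Longrightarrow> \<bar>e\<bar> \<le> \<delta> \<Longrightarrow> \<exists>b. dens_adm f b \<and> dmean b = dmean (gibbs f r \<tau>) + d \<and>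
       dvar b = dvar (gibbs f r \<tau>) + e - d\<^sup>2 \<and> excess f r \<tau> b \<le> C * (\<bar>d\<bar> + \<bar>e\<bar>)\<^sup>2"
proof -
  let ?g = "gibbs f r \<tau>"
  have g2: "prob_dens2 ?g" by (rule gibbs_prob_dens2[OF ok tau])
  obtain h1 B1 where h1: "h1 \<in> borel_measurable borel" "\<And>u. \<bar>h1 u\<bar> \<le> B1"
    "(LINT u|lborel. h1 u * ?g u) = 0"
    "(LINT u|lborel. (h1 u * (u - dmean ?g)) * ?g u) = 1"
    "(LINT u|lborel. (h1 u * (u - dmean ?g)\<^sup>2) * ?g u) = 0"
    using gibbs_moment_direction[of "(0, 1, 0)"] by auto
  obtain h2 B2 where h2: "h2 \<in> borel_measurable borel" "\<And>u. \<bar>h2 u\<bar> \<le> B2"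
    "(LINT u|lborel. h2 u * ?g u) = 0"
    "(LINT u|lborel. (h2 u * (u - dmean ?g)) * ?g u) = 0"
    "(LINT u|lborel. (h2 u * (u - dmean ?g)\<^sup>2) * ?g u) = 1"
    using gibbs_moment_direction[of "(0, 0, 1)"] by auto
  define B where "B = 1 + \<bar>B1\<bar> + \<bar>B2\<bar>"
  have B: "1 \<le> B" "\<bar>h1 u\<bar> \<le> B" "\<bar>h2 u\<bar> \<le> B" for u
    unfolding B_def using h1(2)[of u] h2(2)[of u] by linarith+
  have int: "integrable lborel (\<lambda>u. (h u * (u - dmean ?g) ^ k) * ?g u)"
    if [measurable]: "h \<in> borel_measurable borel" and hB: "\<And>u. \<bar>h u\<bar> \<le> B" and k: "k \<in> {0, 1, 2}" for h k
  proof (rule Bochner_Integration.integrable_bound)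
    let ?m = "dmean ?g"
    show "integrable lborel (\<lambda>u. B * (?g u + (u - ?m)\<^sup>2 * ?g u))"
      using g2 prob_dens2_sq_moment(1)[OF g2] by (auto simp: prob_dens2_def)
    have [measurable]: "?g \<in> borel_measurable borel" using g2 by (simp add: prob_dens2_def)
    show "(\<lambda>u. (h u * (u - ?m) ^ k) * ?g u) \<in> borel_measurable lborel" by measurable
    show "AE u in lborel. norm ((h u * (u - ?m) ^ k) * ?g u) \<le> norm (B * (?g u + (u - ?m)\<^sup>2 * ?g u))"
    proof (rule AE_I2)
      fix u
      have "\<bar>(u - ?m) ^ k\<bar> \<le> 1 + (u - ?m)\<^sup>2" using k abs_le_one_plus_sq[of "u - ?m"] by auto
      then have "\<bar>h u\<bar> * \<bar>(u - ?m) ^ k\<bar> * ?g u \<le> B * (1 + (u - ?m)\<^sup>2) * ?g u"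
        using hB[of u] B(1) gibbs_pos[OF ok tau, of r u] by (intro mult_right_mono mult_mono) auto
      then show "norm ((h u * (u - ?m) ^ k) * ?g u) \<le> norm (B * (?g u + (u - ?m)\<^sup>2 * ?g u))"
        using gibbs_pos[OF ok tau, of r u] B(1) by (simp add: abs_mult algebra_simps)
    qed
  qed
  show ?thesis
  proof
    show "0 \<le> B\<^sup>2" by simp
    \<comment> \<open>With both \<open>d\<close> and \<open>e\<close> below this radius the combined
      perturbation is bounded by 1/2, as \<open>gibbs_perturbation\<close> demands.\<close>
    show "0 < 1 / (4 * B)" using B(1) by simp
    fix d e :: real
    assume de: "\<bar>d\<bar> \<le> 1 / (4 * B)" "\<bar>e\<bar> \<le> 1 / (4 * B)"
    define h where "h u = d * h1 u + e * h2 u" for u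
    have hb: "\<bar>h u\<bar> \<le> B * (\<bar>d\<bar> + \<bar>e\<bar>)" for u
    proof -
      have "\<bar>h u\<bar> \<le> \<bar>d\<bar> * \<bar>h1 u\<bar> + \<bar>e\<bar> * \<bar>h2 u\<bar>"
        unfolding h_def abs_mult[symmetric] by (rule abs_triangle_ineq)
      also have "\<dots> \<le> \<bar>d\<bar> * B + \<bar>e\<bar> * B" using B by (intro add_mono mult_left_mono) auto
      finally show ?thesis by (simp add: algebra_simps)
    qed
    have small: "B * (\<bar>d\<bar> + \<bar>e\<bar>) \<le> 1 / 2"
    proof -
      have "B * (\<bar>d\<bar> + \<bar>e\<bar>) \<le> B * (1 / (4 * B) + 1 / (4 * B))" using de B(1) by (intro mult_left_mono) auto
      also have "\<dots> = 1 / 2" using B(1) by (simp add: field_simps)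
      finally show ?thesis .
    qed
    have hm: "h \<in> borel_measurable borel" unfolding h_def using h1(1) h2(1) by measurable
    have split: "(LINT u|lborel. (h u * (u - dmean ?g) ^ k) * ?g u)
        = d * (LINT u|lborel. (h1 u * (u - dmean ?g) ^ k) * ?g u) + e * (LINT u|lborel. (h2 u * (u - dmean ?g) ^ k) * ?g u)"
      if "k \<in> {0, 1, 2}" for k
    proof -
      have "(h u * (u - dmean ?g) ^ k) * ?g u
        = d * ((h1 u * (u - dmean ?g) ^ k) * ?g u) + e * ((h2 u * (u - dmean ?g) ^ k) * ?g u)" for u
        by (simp add: h_def algebra_simps)
      then show ?thesis
        using int[OF h1(1) B(2) that] int[OF h2(1) B(3) that]
        by (simp only: Bochner_Integration.integral_add integrable_mult_right integral_mult_right_zero)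
    qed
    have "(LINT u|lborel. h u * ?g u) = 0" "(LINT u|lborel. (h u * (u - dmean ?g)) * ?g u) = d"
      "(LINT u|lborel. (h u * (u - dmean ?g)\<^sup>2) * ?g u) = e"
      using split[of 0] split[of 1] split[of 2] h1 h2 by auto
    from gibbs_perturbation[OF hm hb small this]
    show "\<exists>b. dens_adm f b \<and> dmean b = dmean ?g + d \<and> dvar b = dvar ?g + e - d\<^sup>2 \<and>
       excess f r \<tau> b \<le> B\<^sup>2 * (\<bar>d\<bar> + \<bar>e\<bar>)\<^sup>2"
      by (auto simp: power_mult_distrib)
  qed
qed

end

section \<open>Densities with prescribed mean and variance\<close>

text \<open>A uniform density on an interval may have infinite energy when \<open>f\<close> is
  unbounded there, so \<open>f\<close> is required to be bounded on the support as well. A single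
  \<open>N\<close> for all bounds lets a mixture use the maximum.\<close>

definition tame_dens :: "(real \<Rightarrow> real) \<Rightarrow> real \<Rightarrow> (real \<Rightarrow> real) \<Rightarrow> bool" where
  "tame_dens f N b \<longleftrightarrow> b \<in> borel_measurable borel \<and> (LINT u|lborel. b u) = 1 \<and>
     (\<forall>u. 0 \<le> b u \<and> b u \<le> N \<and> (b u \<noteq> 0 \<longrightarrow> \<bar>f u\<bar> \<le> N \<and> \<bar>u\<bar> \<le> N))"

lemma integrable_bounded_support:
  fixes h :: "real \<Rightarrow> real"
  assumes "h \<in> borel_measurable borel" "\<And>u. \<bar>h u\<bar> \<le> C" "\<And>u. N < \<bar>u\<bar> \<Longrightarrow> h u = 0"
  shows "integrable lborel h"
proof (rule Bochner_Integration.integrable_bound)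
  show "integrable lborel (\<lambda>u. C * indicat_real {- N..N} u)"
    by (intro integrable_mult_right integrable_real_indicator) (auto simp: emeasure_lborel_Icc_eq)
  show "AE u in lborel. norm (h u) \<le> norm (C * indicat_real {- N..N} u)"
  proof (rule AE_I2)
    fix u
    show "norm (h u) \<le> norm (C * indicat_real {- N..N} u)"
      using assms(2)[of u] assms(3)[of u] by (cases "N < \<bar>u\<bar>") (auto simp: indicator_def abs_if split: if_splits)
  qed
qed (use assms in auto)

lemma tame_dens_adm:
  assumes f: "f \<in> borel_measurable borel" and b: "tame_dens f N b"
  shows "dens_adm f b"
  unfolding dens_adm_iff prob_dens2_def
proof (intro conjI allI)
  note [measurable] = f
  show bm[measurable]: "b \<in> borel_measurable borel" and "(LINT u|lborel. b u) = 1" and nn: "0 \<le> b u" for u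
    using b by (auto simp: tame_dens_def)
  have bN: "b u \<le> N" "b u \<noteq> 0 \<Longrightarrow> \<bar>f u\<bar> \<le> N" "b u \<noteq> 0 \<Longrightarrow> \<bar>u\<bar> \<le> N" for u
    using b by (auto simp: tame_dens_def)
  have N: "0 \<le> N" using nn[of 0] bN(1)[of 0] by linarith
  have supp: "b u = 0" if "N < \<bar>u\<bar>" for u using bN(3)[of u] that by linarith
  show "integrable lborel b"
    by (rule integrable_bounded_support[where C = N and N = N]) (use nn bN supp in auto)
  show "integrable lborel (\<lambda>u. u\<^sup>2 * b u)"
  proof (rule integrable_bounded_support[where C = "N\<^sup>2 * N" and N = N])
    fix u
    show "\<bar>u\<^sup>2 * b u\<bar> \<le> N\<^sup>2 * N"
    proof (cases "b u = 0")
      case False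
      have "\<bar>u\<bar>\<^sup>2 * b u \<le> N\<^sup>2 * N" using bN[of u] False nn[of u] by (intro mult_mono power_mono) auto
      then show ?thesis using nn[of u] by (simp add: abs_mult)
    qed (use N in auto)
  qed (use supp in auto)
  show "integrable lborel (\<lambda>u. b u * ln (b u) + b u * f u)"
  proof (rule integrable_bounded_support[where C = "1 + N * N + N * N" and N = N])
    fix u
    show "\<bar>b u * ln (b u) + b u * f u\<bar> \<le> 1 + N * N + N * N"
    proof (cases "b u = 0")
      case False
      then have pos: "0 < b u" using nn[of u] by simp
      have "b u * \<bar>f u\<bar> \<le> N * N" using bN[of u] False nn[of u] N by (intro mult_mono) auto
      \<comment> \<open>The entropy term lies between b - 1 and b squared, so small positive values
        of \<open>b\<close> do no harm.\<close>
      moreover have "b u - 1 \<le> b u * ln (b u)"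
        using relative_entropy_pointwise(1)[of "b u" 1] nn[of u] by simp
      moreover have "b u * ln (b u) \<le> b u * b u"
        using ln_le_minus_one[of "b u"] pos by (intro mult_left_mono) auto
      moreover have "b u * b u \<le> N * N" using bN(1)[of u] nn[of u] by (intro mult_mono) (use N in auto)
      moreover have "\<bar>b u * f u\<bar> = b u * \<bar>f u\<bar>" using pos by (simp add: abs_mult)
      ultimately show ?thesis using pos by linarith
    qed (use N in auto)
  qed (use supp in auto)
qed

text \<open>The sublevel sets of the absolute value of \<open>f\<close> exhaust the interval, so one
  of them has positive measure; its normalized indicator serves.\<close>

lemma exists_tame_dens_Ioo:
  assumes f: "f \<in> borel_measurable borel" and pq: "p < (q::real)"
  obtains b N where "tame_dens f N b" "\<And>u. b u \<noteq> 0 \<Longrightarrow> p < u \<and> u < q"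
proof -
  note [measurable] = f
  define S where "S n = {u. \<bar>f u\<bar> \<le> real n} \<inter> {p<..<q}" for n
  have Sm[measurable]: "S n \<in> sets borel" for n unfolding S_def by measurable
  have "\<exists>n. emeasure lborel (S n) \<noteq> 0"
  proof (rule ccontr)
    assume "\<not> ?thesis"
    then have "(\<Union>n. S n) \<in> null_sets lborel" by (intro null_sets_UN) auto
    moreover have "(\<Union>n. S n) = {p<..<q}" unfolding S_def using real_arch_simple by auto
    ultimately have "emeasure lborel {p<..<q} = 0" by auto
    then show False using pq by simp
  qed
  then obtain n where n: "emeasure lborel (S n) \<noteq> 0" by blast
  have fin: "emeasure lborel (S n) < \<infinity>"
  proof -
    have "emeasure lborel (S n) \<le> emeasure lborel {p<..<q}" by (rule emeasure_mono) (auto simp: S_def)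
    also have "\<dots> < \<infinity>" using pq by simp
    finally show ?thesis .
  qed
  define c where "c = measure lborel (S n)"
  have c: "0 < c" unfolding c_def using n fin
    by (simp add: measure_def enn2real_positive_iff zero_less_iff_neq_zero less_top)
  let ?b = "\<lambda>u. indicat_real (S n) u / c"
  let ?N = "real n + \<bar>p\<bar> + \<bar>q\<bar> + 1 / c"
  show ?thesis
  proof
    show "tame_dens f ?N ?b"
      unfolding tame_dens_def
    proof (intro conjI allI impI)
      show "(LINT u|lborel. ?b u) = 1" using fin c by (simp add: c_def)
      fix u
      show "0 \<le> ?b u" using c by simp
      have "?b u \<le> 1 / c" using c by (simp add: divide_right_mono indicator_def)
      then show "?b u \<le> ?N" by linarith
      assume "?b u \<noteq> 0"
      then have u: "u \<in> S n" by (auto simp: indicator_def split: if_splits)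
      have "0 < 1 / c" using c by simp
      moreover have "\<bar>f u\<bar> \<le> real n" using u unfolding S_def by auto
      ultimately show "\<bar>f u\<bar> \<le> ?N" by linarith
      have "\<bar>u\<bar> \<le> \<bar>p\<bar> + \<bar>q\<bar>" using u unfolding S_def by auto
      then show "\<bar>u\<bar> \<le> ?N" using \<open>0 < 1 / c\<close> by linarith
    qed simp
    show "p < u \<and> u < q" if "?b u \<noteq> 0" for u
      using that by (auto simp: indicator_def S_def split: if_splits)
  qed
qed

text \<open>Stated for the raw second moment because, unlike the variance, it is linear under
  mixtures.\<close>

lemma convex_tame_moments:
  assumes f: "f \<in> borel_measurable borel"
  shows "convex {(dmean b, LINT u|lborel. u\<^sup>2 * b u) | b. \<exists>N. tame_dens f N b}"
    (is "convex ?E")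
proof (rule convexI)
  fix x y and s t :: real
  assume "x \<in> ?E" "y \<in> ?E" and st: "0 \<le> s" "0 \<le> t" "s + t = 1"
  then obtain b1 N1 b2 N2 where b1: "tame_dens f N1 b1" and x: "x = (dmean b1, LINT u|lborel. u\<^sup>2 * b1 u)"
    and b2: "tame_dens f N2 b2" and y: "y = (dmean b2, LINT u|lborel. u\<^sup>2 * b2 u)" by blast
  have p: "prob_dens2 b1" "prob_dens2 b2" using tame_dens_adm[OF f] b1 b2 by (auto simp: dens_adm_iff)
  let ?b = "\<lambda>u. s * b1 u + t * b2 u"
  have i: "integrable lborel b1" "integrable lborel b2" "integrable lborel (\<lambda>u. u * b1 u)"
    "integrable lborel (\<lambda>u. u * b2 u)" "integrable lborel (\<lambda>u. u\<^sup>2 * b1 u)" "integrable lborel (\<lambda>u. u\<^sup>2 * b2 u)"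
    using p prob_dens2_integrable_mean by (auto simp: prob_dens2_def)
  have "tame_dens f (max N1 N2) ?b"
    unfolding tame_dens_def
  proof (intro conjI allI impI)
    show "?b \<in> borel_measurable borel" using b1 b2 by (auto simp: tame_dens_def)
    show "(LINT u|lborel. ?b u) = 1" using i b1 b2 st by (simp add: tame_dens_def)
    fix u
    have bb: "0 \<le> b1 u" "b1 u \<le> N1" "0 \<le> b2 u" "b2 u \<le> N2" using b1 b2 by (auto simp: tame_dens_def)
    show "0 \<le> ?b u" using bb st by simp
    have "?b u \<le> s * max N1 N2 + t * max N1 N2"
      using bb st by (intro add_mono mult_left_mono) auto
    then show "?b u \<le> max N1 N2" using st by (simp add: distrib_right[symmetric])
    assume "?b u \<noteq> 0"
    then have "b1 u \<noteq> 0 \<or> b2 u \<noteq> 0" by auto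
    then show "\<bar>f u\<bar> \<le> max N1 N2" "\<bar>u\<bar> \<le> max N1 N2"
      using b1 b2 unfolding tame_dens_def by (meson le_max_iff_disj)+
  qed
  moreover have "s *\<^sub>R x + t *\<^sub>R y = (dmean ?b, LINT u|lborel. u\<^sup>2 * ?b u)"
  proof -
    have "(\<lambda>u. u * ?b u) = (\<lambda>u. s * (u * b1 u) + t * (u * b2 u))"
      "(\<lambda>u. u\<^sup>2 * ?b u) = (\<lambda>u. s * (u\<^sup>2 * b1 u) + t * (u\<^sup>2 * b2 u))"
      by (auto simp: algebra_simps)
    then show ?thesis unfolding x y dmean_def using i by simp
  qed
  ultimately show "s *\<^sub>R x + t *\<^sub>R y \<in> ?E" by blast
qed

text \<open>If a moment pair were not attained, a separating line would give a quadratic that is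
  nonpositive everywhere but nonnegative on average at \<open>m \<plusminus> \<surd>v\<close>, hence zero.\<close>

lemma exists_dens_adm:
  assumes f: "f \<in> borel_measurable borel" and v: "0 < v"
  shows "\<exists>b. dens_adm f b \<and> dmean b = m \<and> dvar b = v"
proof -
  define E where "E = {(dmean b, LINT u|lborel. u\<^sup>2 * b u) | b. \<exists>N. tame_dens f N b}"
  have "(m, m\<^sup>2 + v) \<in> E"
  proof (rule ccontr)
    assume "(m, m\<^sup>2 + v) \<notin> E"
    moreover have "convex E" unfolding E_def by (rule convex_tame_moments[OF f])
    moreover obtain b N where "tame_dens f N b" by (rule exists_tame_dens_Ioo[OF f, of 0 1]) simp
    then have "E \<noteq> {}" unfolding E_def by blast
    ultimately have "\<exists>a c. a \<noteq> 0 \<and> (\<forall>x\<in>E. a \<bullet> x \<le> c) \<and> (\<forall>x\<in>{(m, m\<^sup>2 + v)}. c \<le> a \<bullet> x)"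
      by (intro separating_hyperplane_sets) auto
    then obtain a c where a: "a \<noteq> 0" and ac: "\<And>x. x \<in> E \<Longrightarrow> a \<bullet> x \<le> c" "c \<le> a \<bullet> (m, m\<^sup>2 + v)"
      by blast
    obtain a1 a2 where a12: "a = (a1, a2)" by fastforce
    define Q where "Q u = - c + a1 * u + a2 * u\<^sup>2" for u
    have Q: "Q u0 \<le> 0" for u0
    proof (rule ccontr)
      assume "\<not> Q u0 \<le> 0"
      then have u0: "u0 \<in> {u. 0 < Q u}" by simp
      have op: "open {u. 0 < Q u}" unfolding Q_def by (intro open_Collect_less continuous_intros)
      from bspec[OF op[unfolded open_dist] u0] obtain e where e: "0 < e" "\<And>u. \<bar>u - u0\<bar> < e \<Longrightarrow> 0 < Q u"
        by (auto simp: dist_real_def)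
      obtain b N where b: "tame_dens f N b" and supp: "\<And>u. b u \<noteq> 0 \<Longrightarrow> u0 - e < u \<and> u < u0 + e"
        by (rule exists_tame_dens_Ioo[OF f, of "u0 - e" "u0 + e"]) (use e(1) in auto)
      have p: "prob_dens2 b" using tame_dens_adm[OF f b] by (auto simp: dens_adm_iff)
      have "(dmean b, LINT u|lborel. u\<^sup>2 * b u) \<in> E" unfolding E_def using b by blast
      from ac(1)[OF this] have le: "(LINT u|lborel. Q u * b u) \<le> 0"
        unfolding a12 Q_def prob_dens2_poly_moment[OF p] prob_dens2_second_moment[OF p] by simp
      have i: "integrable lborel (\<lambda>u. Q u * b u)" unfolding Q_def by (rule prob_dens2_integrable_poly[OF p])
      have Qb: "0 < Q u" if "b u \<noteq> 0" for u using supp[OF that] e(2)[of u] by (simp add: abs_less_iff)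
      have nn: "0 \<le> Q u * b u" for u
        using Qb[of u] p by (cases "b u = 0") (auto simp: prob_dens2_def less_imp_le)
      have "(LINT u|lborel. Q u * b u) = 0" using le nn by (simp add: antisym integral_nonneg_AE)
      then have "AE u in lborel. Q u * b u = 0" using integral_nonneg_eq_0_iff_AE[OF i] nn by simp
      then have "AE u in lborel. b u = 0" by eventually_elim (use Qb in fastforce)
      then have "(LINT u|lborel. b u) = 0" by (rule integral_eq_zero_AE)
      then show False using b by (simp add: tame_dens_def)
    qed
    define \<sigma> where "\<sigma> = sqrt v"
    have s: "0 < \<sigma>" "\<sigma>\<^sup>2 = v" unfolding \<sigma>_def using v by auto
    have sum: "0 \<le> Q (m + \<sigma>) + Q (m - \<sigma>)"
      using ac(2) unfolding a12 Q_def s(2)[symmetric] by (simp add: power2_eq_square algebra_simps)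
    have z: "Q (m + \<sigma>) = 0" "Q (m - \<sigma>) = 0" using sum Q[of "m + \<sigma>"] Q[of "m - \<sigma>"] by linarith+
    \<comment> \<open>With zeros at m \<plusminus> \<sigma>, the sign of \<open>Q\<close> at the
      midpoint gives a2 \<ge> 0 and its sign at an outer point gives a2 \<le> 0.\<close>
    have "Q m = (Q (m + \<sigma>) + Q (m - \<sigma>)) / 2 - a2 * v"
      unfolding Q_def s(2)[symmetric] by (simp add: power2_eq_square field_simps)
    then have "0 \<le> a2 * v" using z Q[of m] by simp
    moreover have "Q (m + 2 * \<sigma>) = 3 / 2 * Q (m + \<sigma>) - Q (m - \<sigma>) / 2 + 3 * (a2 * v)"
      unfolding Q_def s(2)[symmetric] by (simp add: power2_eq_square field_simps)
    then have "a2 * v \<le> 0" using z Q[of "m + 2 * \<sigma>"] by simp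
    ultimately have a2: "a2 = 0" using v by (simp add: antisym zero_le_mult_iff mult_le_0_iff)
    then have "a1 = 0" using z s(1) unfolding Q_def by (simp add: algebra_simps)
    then show False using a a2 a12 by (simp add: zero_prod_def)
  qed
  then obtain b N where b: "tame_dens f N b" "dmean b = m" "(LINT u|lborel. u\<^sup>2 * b u) = m\<^sup>2 + v"
    unfolding E_def by auto
  have adm: "dens_adm f b" by (rule tame_dens_adm[OF f b(1)])
  then have "dvar b = v" using prob_dens2_second_moment[of b] b by (simp add: dens_adm_iff)
  then show ?thesis using adm b(2) by blast
qed

section \<open>One-dimensional free energies\<close>

text \<open>The error hypothesis at \<open>y = x\<close> makes both functions agree there; the
  difference quotient of the error is then at most C times the distance. \<open>L\<close> is the
  explicit comparison function, \<phi> the infimum.\<close>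

lemma has_real_derivative_quadratic_error:
  fixes \<phi> L :: "real \<Rightarrow> real"
  assumes L: "(L has_real_derivative D) (at x)" and \<delta>: "0 < \<delta>"
    and err: "\<And>y. \<bar>y - x\<bar> < \<delta> \<Longrightarrow> \<bar>\<phi> y - L y\<bar> \<le> C * (y - x)\<^sup>2"
  shows "(\<phi> has_real_derivative D) (at x)"
proof -
  define E where "E y = \<phi> y - L y" for y
  have Ex: "E x = 0" unfolding E_def using err[of x] \<delta> by simp
  have "(E has_real_derivative 0) (at x)"
    unfolding has_field_derivative_iff
  proof (rule Lim_null_comparison)
    show "\<forall>\<^sub>F y in at x. norm ((E y - E x) / (y - x)) \<le> C * \<bar>y - x\<bar>"
      unfolding eventually_at
    proof (intro exI[of _ \<delta>] conjI ballI impI)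
      fix y assume y: "y \<noteq> x \<and> dist y x < \<delta>"
      then have "\<bar>E y\<bar> \<le> C * \<bar>y - x\<bar>\<^sup>2" unfolding E_def using err[of y] by (simp add: dist_real_def)
      then show "norm ((E y - E x) / (y - x)) \<le> C * \<bar>y - x\<bar>"
        using y by (simp add: Ex abs_divide divide_le_eq power2_eq_square mult.assoc)
    qed (fact \<delta>)
    have "((\<lambda>y. C * \<bar>y - x\<bar>) \<longlongrightarrow> C * \<bar>x - x\<bar>) (at x)" by (intro tendsto_intros)
    then show "((\<lambda>y. C * \<bar>y - x\<bar>) \<longlongrightarrow> 0) (at x)" by simp
  qed
  from DERIV_add[OF L this] show ?thesis unfolding E_def by simp
qed

lemma linear_le_quadratic_imp_0:
  fixes D K \<delta> :: real
  assumes "0 < \<delta>" and le: "\<And>\<epsilon>. \<bar>\<epsilon>\<bar> \<le> \<delta> \<Longrightarrow> \<epsilon> * D \<le> \<epsilon>\<^sup>2 * K"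
  shows "D = 0"
proof (rule ccontr)
  assume D: "D \<noteq> 0"
  \<comment> \<open>Testing with \<epsilon> = t sgn D gives |D| \<le> t K, and the second entry of
    the minimum makes the right side at most |D| / 2.\<close>
  define t where "t = min \<delta> (\<bar>D\<bar> / (2 * (\<bar>K\<bar> + 1)))"
  have t: "0 < t" "t \<le> \<delta>" "t \<le> \<bar>D\<bar> / (2 * (\<bar>K\<bar> + 1))" unfolding t_def using D \<open>0 < \<delta>\<close> by auto
  have s: "sgn D * D = \<bar>D\<bar>" "\<bar>sgn D\<bar> = 1" "(sgn D)\<^sup>2 = 1"
    using D by (auto simp: sgn_if power2_eq_square)
  have "(t * sgn D) * D \<le> (t * sgn D)\<^sup>2 * K" using t s(2) by (intro le) (simp add: abs_mult)
  then have "t * \<bar>D\<bar> \<le> t * (t * K)" using s(1) s(3) by (simp add: mult.assoc power_mult_distrib) (simp add: power2_eq_square)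
  then have "\<bar>D\<bar> \<le> t * K" using t(1) by simp
  also have "\<dots> \<le> t * (\<bar>K\<bar> + 1)" using t(1) by (intro mult_left_mono) auto
  also have "\<dots> \<le> \<bar>D\<bar> / 2" using t(3) by (simp add: field_simps)
  finally show False using D by simp
qed

text \<open>The real-valued contribution of one coordinate to the x free energy. A real infimum is
  meaningful only over a nonempty set with a lower bound; \<open>exists_dens_adm\<close> and
  \<open>excess_nonneg\<close> provide these.\<close>

definition min_kl :: "(real \<Rightarrow> real) \<Rightarrow> real \<Rightarrow> real \<Rightarrow> real" where
  "min_kl f m v = Inf (kl1 f ` {b. dens_adm f b \<and> dmean b = m \<and> dvar b = v})"

definition min_kl_gauss :: "(real \<Rightarrow> real) \<Rightarrow> real \<Rightarrow> real \<Rightarrow> real" where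
  "min_kl_gauss f m \<tau> =
     Inf ((\<lambda>b. kl1 f b + (dvar b / (2 * \<tau>) + ln (2 * pi * \<tau>) / 2)) ` {b. dens_adm f b \<and> dmean b = m})"

context
  fixes f :: "real \<Rightarrow> real" and r \<tau> :: real
  assumes ok: "potential_ok f" and tau: "0 < \<tau>"
begin

text \<open>The left side does not involve \<open>r\<close> and \<open>\<tau>\<close>, so every
  Gibbs density gives its own decomposition of the same functional.\<close>

lemma kl1_eq_excess:
  "kl1 f b = excess f r \<tau> b - (dvar b + (dmean b - r)\<^sup>2) / (2 * \<tau>) - ln (gibbs_Z f r \<tau>)"
  unfolding excess_def[OF ok tau] by simp

lemma kl1_gauss_eq_excess:
  "kl1 f b + (dvar b / (2 * \<tau>) + c) = excess f r \<tau> b - (dmean b - r)\<^sup>2 / (2 * \<tau>) - ln (gibbs_Z f r \<tau>) + c"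
  unfolding kl1_eq_excess by (simp add: add_divide_distrib)

lemma bdd_below_min_kl: "bdd_below (kl1 f ` {b. dens_adm f b \<and> dmean b = m \<and> dvar b = v})"
  by (rule bdd_belowI2[where m = "- ((v + (m - r)\<^sup>2) / (2 * \<tau>)) - ln (gibbs_Z f r \<tau>)"])
    (use excess_nonneg[OF ok tau, of _ r] in \<open>auto simp: kl1_eq_excess\<close>)

lemma bdd_below_min_kl_gauss:
  "bdd_below ((\<lambda>b. kl1 f b + (dvar b / (2 * \<tau>) + c)) ` {b. dens_adm f b \<and> dmean b = m})"
  by (rule bdd_belowI2[where m = "- ((m - r)\<^sup>2 / (2 * \<tau>)) - ln (gibbs_Z f r \<tau>) + c"])
    (use excess_nonneg[OF ok tau, of _ r] in \<open>auto simp: kl1_gauss_eq_excess\<close>)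

lemma min_kl_le:
  assumes "dens_adm f b" "dmean b = m" "dvar b = v"
  shows "min_kl f m v \<le> excess f r \<tau> b - (v + (m - r)\<^sup>2) / (2 * \<tau>) - ln (gibbs_Z f r \<tau>)"
proof -
  have "min_kl f m v \<le> kl1 f b"
    unfolding min_kl_def using assms by (intro cInf_lower bdd_below_min_kl) auto
  then show ?thesis using assms by (simp add: kl1_eq_excess)
qed

text \<open>On the constraint set \<open>kl1\<close> and the excess differ by a constant, so a
  uniform bound on one passes to the infimum of the other. Positive variance makes the set
  nonempty.\<close>

lemma min_kl_ge:
  assumes v: "0 < v"
    and c: "\<And>b. dens_adm f b \<Longrightarrow> dmean b = m \<Longrightarrow> dvar b = v \<Longrightarrow> c \<le> excess f r \<tau> b"
  shows "c - (v + (m - r)\<^sup>2) / (2 * \<tau>) - ln (gibbs_Z f r \<tau>) \<le> min_kl f m v"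
  unfolding min_kl_def
proof (rule cInf_greatest)
  have "f \<in> borel_measurable borel" using ok by (simp add: potential_ok_def)
  then show "kl1 f ` {b. dens_adm f b \<and> dmean b = m \<and> dvar b = v} \<noteq> {}"
    using exists_dens_adm[OF _ v, of f m] by auto
  fix y assume "y \<in> kl1 f ` {b. dens_adm f b \<and> dmean b = m \<and> dvar b = v}"
  then show "c - (v + (m - r)\<^sup>2) / (2 * \<tau>) - ln (gibbs_Z f r \<tau>) \<le> y" using c by (auto simp: kl1_eq_excess)
qed

lemma min_kl_lower:
  assumes "0 < v"
  shows "- ((v + (m - r)\<^sup>2) / (2 * \<tau>)) - ln (gibbs_Z f r \<tau>) \<le> min_kl f m v"
  using min_kl_ge[OF assms, of m 0] excess_nonneg[OF ok tau] by simp

lemma min_kl_gauss_le: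
  assumes "dens_adm f b" "dmean b = m"
  shows "min_kl_gauss f m \<tau> \<le> excess f r \<tau> b - (m - r)\<^sup>2 / (2 * \<tau>) - ln (gibbs_Z f r \<tau>) + ln (2 * pi * \<tau>) / 2"
proof -
  have "min_kl_gauss f m \<tau> \<le> kl1 f b + (dvar b / (2 * \<tau>) + ln (2 * pi * \<tau>) / 2)"
    unfolding min_kl_gauss_def using assms by (intro cInf_lower bdd_below_min_kl_gauss) auto
  then show ?thesis using assms by (simp add: kl1_gauss_eq_excess)
qed

lemma min_kl_gauss_ge:
  assumes c: "\<And>b. dens_adm f b \<Longrightarrow> dmean b = m \<Longrightarrow> c \<le> excess f r \<tau> b"
  shows "c - (m - r)\<^sup>2 / (2 * \<tau>) - ln (gibbs_Z f r \<tau>) + ln (2 * pi * \<tau>) / 2 \<le> min_kl_gauss f m \<tau>"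
  unfolding min_kl_gauss_def
proof (rule cInf_greatest)
  have "f \<in> borel_measurable borel" using ok by (simp add: potential_ok_def)
  then show "(\<lambda>b. kl1 f b + (dvar b / (2 * \<tau>) + ln (2 * pi * \<tau>) / 2)) ` {b. dens_adm f b \<and> dmean b = m} \<noteq> {}"
    using exists_dens_adm[of f 1 m] by auto
  fix y assume "y \<in> (\<lambda>b. kl1 f b + (dvar b / (2 * \<tau>) + ln (2 * pi * \<tau>) / 2)) ` {b. dens_adm f b \<and> dmean b = m}"
  then show "c - (m - r)\<^sup>2 / (2 * \<tau>) - ln (gibbs_Z f r \<tau>) + ln (2 * pi * \<tau>) / 2 \<le> y"
    using c by (auto simp: kl1_gauss_eq_excess)
qed

lemma min_kl_gauss_lower:
  "- ((m - r)\<^sup>2 / (2 * \<tau>)) - ln (gibbs_Z f r \<tau>) + ln (2 * pi * \<tau>) / 2 \<le> min_kl_gauss f m \<tau>"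
  using min_kl_gauss_ge[of m 0] excess_nonneg[OF ok tau] by simp

lemma min_kl_gibbs:
  "min_kl f (dmean (gibbs f r \<tau>)) (dvar (gibbs f r \<tau>)) =
     - ((dvar (gibbs f r \<tau>) + (dmean (gibbs f r \<tau>) - r)\<^sup>2) / (2 * \<tau>)) - ln (gibbs_Z f r \<tau>)"
  using min_kl_le[OF gibbs_adm[OF ok tau, of r] refl refl]
    min_kl_lower[OF gibbs_dvar_pos[OF ok tau, of r], of "dmean (gibbs f r \<tau>)"] excess_gibbs[OF ok tau, of r]
  by simp

lemma min_kl_gauss_gibbs:
  "min_kl_gauss f (dmean (gibbs f r \<tau>)) \<tau> =
     - ((dmean (gibbs f r \<tau>) - r)\<^sup>2 / (2 * \<tau>)) - ln (gibbs_Z f r \<tau>) + ln (2 * pi * \<tau>) / 2"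
  using min_kl_gauss_le[OF gibbs_adm[OF ok tau, of r] refl]
    min_kl_gauss_lower[of "dmean (gibbs f r \<tau>)"] excess_gibbs[OF ok tau, of r]
  by simp

text \<open>The hypothesis says that the least excess at (m, v) is at most 0. The tilted bound,
  being uniform over the densities with these moments, survives the infimum and forces each linear
  combination of moment deviations to vanish.\<close>

lemma min_kl_unique:
  assumes v: "0 < v"
    and le: "min_kl f m v \<le> - ((v + (m - r)\<^sup>2) / (2 * \<tau>)) - ln (gibbs_Z f r \<tau>)"
  shows "m = dmean (gibbs f r \<tau>)" "v = dvar (gibbs f r \<tau>)"
proof -
  let ?g = "gibbs f r \<tau>"
  obtain K where K: "\<And>b \<alpha> \<beta> \<epsilon>. dens_adm f b \<Longrightarrow> \<bar>\<alpha>\<bar> \<le> 1 \<Longrightarrow> \<bar>\<beta>\<bar> \<le> 1 \<Longrightarrow> \<bar>\<epsilon>\<bar> \<le> 1 / (32 * \<tau>) \<Longrightarrow>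
    \<epsilon> * (\<alpha> * (dmean b - dmean ?g) + \<beta> * ((dvar b + (dmean b)\<^sup>2) - (dvar ?g + (dmean ?g)\<^sup>2))) - \<epsilon>\<^sup>2 * K
      \<le> excess f r \<tau> b"
    using excess_lower_bound[OF ok tau, of r] by blast
  have z: "\<alpha> * (m - dmean ?g) + \<beta> * ((v + m\<^sup>2) - (dvar ?g + (dmean ?g)\<^sup>2)) = 0"
    if "\<bar>\<alpha>\<bar> \<le> 1" "\<bar>\<beta>\<bar> \<le> 1" for \<alpha> \<beta>
  proof (rule linear_le_quadratic_imp_0)
    show "0 < 1 / (32 * \<tau>)" using tau by simp
    fix \<epsilon> :: real assume e: "\<bar>\<epsilon>\<bar> \<le> 1 / (32 * \<tau>)"
    let ?D = "\<alpha> * (m - dmean ?g) + \<beta> * ((v + m\<^sup>2) - (dvar ?g + (dmean ?g)\<^sup>2))"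
    have "\<epsilon> * ?D - \<epsilon>\<^sup>2 * K \<le> excess f r \<tau> b" if "dens_adm f b" "dmean b = m" "dvar b = v" for b
      using K[OF that(1) \<open>\<bar>\<alpha>\<bar> \<le> 1\<close> \<open>\<bar>\<beta>\<bar> \<le> 1\<close> e] that by simp
    from min_kl_ge[OF v, of m, OF this] le show "\<epsilon> * ?D \<le> \<epsilon>\<^sup>2 * K" by linarith
  qed
  from z[of 1 0] show m: "m = dmean ?g" by simp
  from z[of 0 1] m show "v = dvar ?g" by simp
qed

lemma min_kl_gauss_unique:
  assumes le: "min_kl_gauss f m \<tau> \<le> - ((m - r)\<^sup>2 / (2 * \<tau>)) - ln (gibbs_Z f r \<tau>) + ln (2 * pi * \<tau>) / 2"
  shows "m = dmean (gibbs f r \<tau>)"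
proof -
  let ?g = "gibbs f r \<tau>"
  obtain K where K: "\<And>b \<alpha> \<beta> \<epsilon>. dens_adm f b \<Longrightarrow> \<bar>\<alpha>\<bar> \<le> 1 \<Longrightarrow> \<bar>\<beta>\<bar> \<le> 1 \<Longrightarrow> \<bar>\<epsilon>\<bar> \<le> 1 / (32 * \<tau>) \<Longrightarrow>
    \<epsilon> * (\<alpha> * (dmean b - dmean ?g) + \<beta> * ((dvar b + (dmean b)\<^sup>2) - (dvar ?g + (dmean ?g)\<^sup>2))) - \<epsilon>\<^sup>2 * K
      \<le> excess f r \<tau> b"
    using excess_lower_bound[OF ok tau, of r] by blast
  have "m - dmean ?g = 0"
  proof (rule linear_le_quadratic_imp_0)
    show "0 < 1 / (32 * \<tau>)" using tau by simp
    fix \<epsilon> :: real assume e: "\<bar>\<epsilon>\<bar> \<le> 1 / (32 * \<tau>)"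
    have "\<epsilon> * (m - dmean ?g) - \<epsilon>\<^sup>2 * K \<le> excess f r \<tau> b" if "dens_adm f b" "dmean b = m" for b
      using K[OF that(1), of 1 0 \<epsilon>] e that by simp
    from min_kl_gauss_ge[of m, OF this] le show "\<epsilon> * (m - dmean ?g) \<le> \<epsilon>\<^sup>2 * K" by linarith
  qed
  then show ?thesis by simp
qed

section \<open>Derivatives of the one-dimensional free energies at Gibbs moments\<close>

lemma min_kl_deriv_mean:
  "((\<lambda>u. min_kl f u (dvar (gibbs f r \<tau>))) has_real_derivative (r - dmean (gibbs f r \<tau>)) / \<tau>)
     (at (dmean (gibbs f r \<tau>)))"
proof -
  let ?g = "gibbs f r \<tau>"
  obtain C \<delta> where C: "0 \<le> C" "0 < \<delta>"
    "\<And>d e. \<bar>d\<bar> \<le> \<delta> \<Longrightarrow> \<bar>e\<bar> \<le> \<delta> \<Longrightarrow> \<exists>b. dens_adm f b \<and> dmean b = dmean ?g + d \<and>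
       dvar b = dvar ?g + e - d\<^sup>2 \<and> excess f r \<tau> b \<le> C * (\<bar>d\<bar> + \<bar>e\<bar>)\<^sup>2"
    using excess_upper_bound[OF ok tau, of r] by blast
  show ?thesis
  proof (rule has_real_derivative_quadratic_error)
    show "((\<lambda>u. - ((dvar ?g + (u - r)\<^sup>2) / (2 * \<tau>)) - ln (gibbs_Z f r \<tau>)) has_real_derivative (r - dmean ?g) / \<tau>)
       (at (dmean ?g))"
      using tau by (auto intro!: derivative_eq_intros simp: field_simps)
    show "0 < min \<delta> 1" using C(2) by simp
    fix u assume u: "\<bar>u - dmean ?g\<bar> < min \<delta> 1"
    let ?d = "u - dmean ?g"
    have "?d\<^sup>2 = \<bar>?d\<bar> * \<bar>?d\<bar>" by (simp add: power2_eq_square)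
    also have "\<dots> \<le> \<bar>?d\<bar> * 1" using u by (intro mult_left_mono) auto
    finally have d2: "?d\<^sup>2 \<le> \<bar>?d\<bar>" by simp
    then obtain b where b: "dens_adm f b" "dmean b = u" "dvar b = dvar ?g" "excess f r \<tau> b \<le> C * (\<bar>?d\<bar> + ?d\<^sup>2)\<^sup>2"
      using C(3)[of ?d "?d\<^sup>2"] u by auto
    have "C * (\<bar>?d\<bar> + ?d\<^sup>2)\<^sup>2 \<le> C * (2 * \<bar>?d\<bar>)\<^sup>2" using d2 C(1) by (intro mult_left_mono power_mono) auto
    also have "\<dots> = 4 * C * ?d\<^sup>2" by (simp add: power_mult_distrib)
    finally have "excess f r \<tau> b \<le> 4 * C * ?d\<^sup>2" using b(4) by linarith
    then show "\<bar>min_kl f u (dvar ?g) - (- ((dvar ?g + (u - r)\<^sup>2) / (2 * \<tau>)) - ln (gibbs_Z f r \<tau>))\<bar> \<le> 4 * C * ?d\<^sup>2"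
      using min_kl_le[OF b(1,2,3)] min_kl_lower[OF gibbs_dvar_pos[OF ok tau, of r], of u] by linarith
  qed
qed

lemma min_kl_deriv_var:
  "((\<lambda>u. min_kl f (dmean (gibbs f r \<tau>)) u) has_real_derivative - (1 / (2 * \<tau>))) (at (dvar (gibbs f r \<tau>)))"
proof -
  let ?g = "gibbs f r \<tau>"
  obtain C \<delta> where C: "0 \<le> C" "0 < \<delta>"
    "\<And>d e. \<bar>d\<bar> \<le> \<delta> \<Longrightarrow> \<bar>e\<bar> \<le> \<delta> \<Longrightarrow> \<exists>b. dens_adm f b \<and> dmean b = dmean ?g + d \<and>
       dvar b = dvar ?g + e - d\<^sup>2 \<and> excess f r \<tau> b \<le> C * (\<bar>d\<bar> + \<bar>e\<bar>)\<^sup>2"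
    using excess_upper_bound[OF ok tau, of r] by blast
  have v: "0 < dvar ?g" by (rule gibbs_dvar_pos[OF ok tau])
  show ?thesis
  proof (rule has_real_derivative_quadratic_error)
    show "((\<lambda>u. - ((u + (dmean ?g - r)\<^sup>2) / (2 * \<tau>)) - ln (gibbs_Z f r \<tau>)) has_real_derivative - (1 / (2 * \<tau>)))
       (at (dvar ?g))"
      using tau by (auto intro!: derivative_eq_intros simp: field_simps)
    \<comment> \<open>The second radius keeps the varied variance positive, where the lower bound on
      the infimum is available.\<close>
    show "0 < min \<delta> (dvar ?g)" using C(2) v by simp
    fix u assume u: "\<bar>u - dvar ?g\<bar> < min \<delta> (dvar ?g)"
    then have u0: "0 < u" by linarith
    obtain b where b: "dens_adm f b" "dmean b = dmean ?g" "dvar b = u" "excess f r \<tau> b \<le> C * (u - dvar ?g)\<^sup>2"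
      using C(3)[of 0 "u - dvar ?g"] u C(2) by auto
    then show "\<bar>min_kl f (dmean ?g) u - (- ((u + (dmean ?g - r)\<^sup>2) / (2 * \<tau>)) - ln (gibbs_Z f r \<tau>))\<bar>
        \<le> C * (u - dvar ?g)\<^sup>2"
      using min_kl_le[OF b(1,2,3)] min_kl_lower[OF u0, of "dmean ?g"] by linarith
  qed
qed

lemma min_kl_gauss_deriv_mean:
  "((\<lambda>u. min_kl_gauss f u \<tau>) has_real_derivative (r - dmean (gibbs f r \<tau>)) / \<tau>) (at (dmean (gibbs f r \<tau>)))"
proof -
  let ?g = "gibbs f r \<tau>"
  obtain C \<delta> where C: "0 \<le> C" "0 < \<delta>"
    "\<And>d e. \<bar>d\<bar> \<le> \<delta> \<Longrightarrow> \<bar>e\<bar> \<le> \<delta> \<Longrightarrow> \<exists>b. dens_adm f b \<and> dmean b = dmean ?g + d \<and>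
       dvar b = dvar ?g + e - d\<^sup>2 \<and> excess f r \<tau> b \<le> C * (\<bar>d\<bar> + \<bar>e\<bar>)\<^sup>2"
    using excess_upper_bound[OF ok tau, of r] by blast
  show ?thesis
  proof (rule has_real_derivative_quadratic_error)
    show "((\<lambda>u. - ((u - r)\<^sup>2 / (2 * \<tau>)) - ln (gibbs_Z f r \<tau>) + ln (2 * pi * \<tau>) / 2) has_real_derivative
       (r - dmean ?g) / \<tau>) (at (dmean ?g))"
      using tau by (auto intro!: derivative_eq_intros simp: field_simps)
    show "0 < \<delta>" by fact
    fix u assume u: "\<bar>u - dmean ?g\<bar> < \<delta>"
    \<comment> \<open>Here the variance is free, so no compensating \<open>e\<close> is
      required.\<close>
    obtain b where b: "dens_adm f b" "dmean b = u" "excess f r \<tau> b \<le> C * (u - dmean ?g)\<^sup>2"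
      using C(3)[of "u - dmean ?g" 0] u C(2) by auto
    then show "\<bar>min_kl_gauss f u \<tau> - (- ((u - r)\<^sup>2 / (2 * \<tau>)) - ln (gibbs_Z f r \<tau>) + ln (2 * pi * \<tau>) / 2)\<bar>
        \<le> C * (u - dmean ?g)\<^sup>2"
      using min_kl_gauss_le[OF b(1,2)] min_kl_gauss_lower[of u] by linarith
  qed
qed

end

lemma min_kl_gauss_deriv_tau:
  assumes ok: "potential_ok f" and tau: "0 < \<tau>"
  shows "((\<lambda>t. min_kl_gauss f (dmean (gibbs f r \<tau>)) t) has_real_derivative
     (1 / \<tau> - dvar (gibbs f r \<tau>) / \<tau>\<^sup>2) / 2) (at \<tau>)"
proof -
  let ?g = "gibbs f r \<tau>"
  let ?L = "\<lambda>t. kl1 f ?g + (dvar ?g / (2 * t) + ln (2 * pi * t) / 2)"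
  obtain K where K: "\<And>b \<alpha> \<beta> \<epsilon>. dens_adm f b \<Longrightarrow> \<bar>\<alpha>\<bar> \<le> 1 \<Longrightarrow> \<bar>\<beta>\<bar> \<le> 1 \<Longrightarrow> \<bar>\<epsilon>\<bar> \<le> 1 / (32 * \<tau>) \<Longrightarrow>
    \<epsilon> * (\<alpha> * (dmean b - dmean ?g) + \<beta> * ((dvar b + (dmean b)\<^sup>2) - (dvar ?g + (dmean ?g)\<^sup>2))) - \<epsilon>\<^sup>2 * K
      \<le> excess f r \<tau> b"
    using excess_lower_bound[OF ok tau, of r] by blast
  show ?thesis
  proof (rule has_real_derivative_quadratic_error)
    show "(?L has_real_derivative (1 / \<tau> - dvar ?g / \<tau>\<^sup>2) / 2) (at \<tau>)"
      using tau by (auto intro!: derivative_eq_intros simp: field_simps power2_eq_square)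
    show "0 < \<tau> / 32" using tau by simp
    fix t assume t: "\<bar>t - \<tau>\<bar> < \<tau> / 32"
    then have t0: "0 < t" "\<tau> / 2 \<le> t" using tau by linarith+
    \<comment> \<open>The difference of the two variance weights, so that the variance of
      \<open>b\<close> drops out after replacing 1/(2\<tau>) by 1/(2t).\<close>
    define \<epsilon> where "\<epsilon> = 1 / (2 * \<tau>) - 1 / (2 * t)"
    have "\<epsilon> = (t - \<tau>) / (2 * \<tau> * t)" unfolding \<epsilon>_def using tau t0 by (simp add: field_simps)
    then have "\<bar>\<epsilon>\<bar> = \<bar>t - \<tau>\<bar> / (2 * \<tau> * t)" using tau t0 by (simp add: abs_mult)
    also have "\<dots> \<le> \<bar>t - \<tau>\<bar> / \<tau>\<^sup>2"
    proof (rule divide_left_mono)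
      show "\<tau>\<^sup>2 \<le> 2 * \<tau> * t" using tau t0 by (simp add: power2_eq_square)
    qed (use tau t0 in auto)
    finally have e: "\<bar>\<epsilon>\<bar> \<le> \<bar>t - \<tau>\<bar> / \<tau>\<^sup>2" .
    also have "\<dots> \<le> (\<tau> / 32) / \<tau>\<^sup>2" using t by (intro divide_right_mono) auto
    also have "\<dots> = 1 / (32 * \<tau>)" using tau by (simp add: power2_eq_square)
    finally have e32: "\<bar>\<epsilon>\<bar> \<le> 1 / (32 * \<tau>)" .
    have "\<epsilon>\<^sup>2 * K \<le> \<bar>\<epsilon>\<bar>\<^sup>2 * \<bar>K\<bar>" by (simp add: mult_left_mono)
    also have "\<dots> \<le> (\<bar>t - \<tau>\<bar> / \<tau>\<^sup>2)\<^sup>2 * \<bar>K\<bar>" using e by (intro mult_right_mono power_mono) auto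
    finally have eK: "\<epsilon>\<^sup>2 * K \<le> \<bar>K\<bar> / (\<tau>\<^sup>2)\<^sup>2 * (t - \<tau>)\<^sup>2" by (simp add: power_divide mult.commute)
    have up: "min_kl_gauss f (dmean ?g) t \<le> ?L t"
      unfolding min_kl_gauss_def using gibbs_adm[OF ok tau]
      by (intro cInf_lower bdd_below_min_kl_gauss[OF ok t0(1)]) auto
    have "?L t - \<epsilon>\<^sup>2 * K \<le> min_kl_gauss f (dmean ?g) t"
      unfolding min_kl_gauss_def
    proof (rule cInf_greatest)
      fix y assume "y \<in> (\<lambda>b. kl1 f b + (dvar b / (2 * t) + ln (2 * pi * t) / 2)) ` {b. dens_adm f b \<and> dmean b = dmean ?g}"
      then obtain b where b: "dens_adm f b" "dmean b = dmean ?g"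
        and y: "y = kl1 f b + (dvar b / (2 * t) + ln (2 * pi * t) / 2)" by auto
      have "\<epsilon> * (dvar b - dvar ?g) - \<epsilon>\<^sup>2 * K \<le> excess f r \<tau> b"
        using K[OF b(1), of 0 1 \<epsilon>] e32 b(2) by simp
      moreover have "kl1 f b = excess f r \<tau> b - (dvar b + (dmean ?g - r)\<^sup>2) / (2 * \<tau>) - ln (gibbs_Z f r \<tau>)"
        using kl1_eq_excess[OF ok tau, of b r] b(2) by simp
      moreover have "kl1 f ?g = - ((dvar ?g + (dmean ?g - r)\<^sup>2) / (2 * \<tau>)) - ln (gibbs_Z f r \<tau>)"
        using kl1_eq_excess[OF ok tau, of ?g r] excess_gibbs[OF ok tau, of r] by simp
      ultimately have "kl1 f ?g + (dvar ?g - dvar b) / (2 * \<tau>) + \<epsilon> * (dvar b - dvar ?g) - \<epsilon>\<^sup>2 * K \<le> kl1 f b"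
        by (simp add: add_divide_distrib diff_divide_distrib)
      moreover have "(dvar ?g - dvar b) / (2 * \<tau>) + \<epsilon> * (dvar b - dvar ?g) = dvar ?g / (2 * t) - dvar b / (2 * t)"
        unfolding \<epsilon>_def by (simp add: algebra_simps diff_divide_distrib)
      ultimately show "?L t - \<epsilon>\<^sup>2 * K \<le> y" unfolding y by linarith
    qed (use gibbs_adm[OF ok tau] in auto)
    with up eK show "\<bar>min_kl_gauss f (dmean ?g) t - ?L t\<bar> \<le> \<bar>K\<bar> / (\<tau>\<^sup>2)\<^sup>2 * (t - \<tau>)\<^sup>2" by linarith
  qed
qed

section \<open>Free energies and Lagrangian in several dimensions\<close>

text \<open>Coordinate infima need not be attained; choosing each coordinate within an equal share
  of \<open>e\<close> keeps the total error below \<open>e\<close>.\<close>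

lemma Inf_separable_sum:
  fixes F :: "'n::finite \<Rightarrow> 'b \<Rightarrow> real"
  assumes ne: "\<And>j. S j \<noteq> {}" and bdd: "\<And>j. bdd_below (F j ` S j)"
  shows "Inf {ereal (\<Sum>j\<in>UNIV. F j (b j)) | b. \<forall>j. b j \<in> S j} = ereal (\<Sum>j\<in>UNIV. Inf (F j ` S j))"
    (is "Inf ?A = ?R")
proof (rule antisym)
  show "?R \<le> Inf ?A"
  proof (rule Inf_greatest)
    fix y assume "y \<in> ?A"
    then obtain b where "y = ereal (\<Sum>j\<in>UNIV. F j (b j))" "\<forall>j. b j \<in> S j" by auto
    then show "?R \<le> y" using bdd by (auto intro!: sum_mono cInf_lower)
  qed
  show "Inf ?A \<le> ?R"
  proof (rule ereal_le_epsilon2)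
    fix e :: real assume e: "0 < e"
    define d where "d = e / real CARD('n)"
    have d: "0 < d" unfolding d_def using e by simp
    have "\<exists>x. x \<in> S j \<and> F j x < Inf (F j ` S j) + d" for j
      using cInf_lessD[of "F j ` S j" "Inf (F j ` S j) + d"] ne[of j] d by auto
    then obtain b where b: "\<And>j. b j \<in> S j" "\<And>j. F j (b j) < Inf (F j ` S j) + d" by metis
    have "(\<Sum>j\<in>UNIV. F j (b j)) \<le> (\<Sum>j\<in>UNIV. Inf (F j ` S j) + d)"
      using b(2) by (intro sum_mono less_imp_le)
    also have "\<dots> = (\<Sum>j\<in>UNIV. Inf (F j ` S j)) + e" by (simp add: sum.distrib d_def)
    finally have "ereal (\<Sum>j\<in>UNIV. F j (b j)) \<le> ?R + ereal e" by simp
    moreover have "Inf ?A \<le> ereal (\<Sum>j\<in>UNIV. F j (b j))" using b(1) by (intro Inf_lower) auto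
    ultimately show "Inf ?A \<le> ?R + ereal e" by (rule order_trans[rotated])
  qed
qed

lemma FxSP_eq:
  assumes ok: "\<And>j. potential_ok (f j)" and v: "\<And>j. 0 < \<tau>x $ j"
  shows "FxSP f xb \<tau>x = ereal (\<Sum>j\<in>UNIV. min_kl (f j) (xb $ j) (\<tau>x $ j))"
proof -
  have "FxSP f xb \<tau>x = Inf {ereal (\<Sum>j\<in>UNIV. kl1 (f j) (b j)) | b.
      \<forall>j. b j \<in> {b. dens_adm (f j) b \<and> dmean b = xb $ j \<and> dvar b = \<tau>x $ j}}"
    unfolding FxSP_def KLprod_def feasible_x_def by simp
  also have "\<dots> = ereal (\<Sum>j\<in>UNIV. min_kl (f j) (xb $ j) (\<tau>x $ j))"
    unfolding min_kl_def
  proof (rule Inf_separable_sum)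
    fix j
    show "{b. dens_adm (f j) b \<and> dmean b = xb $ j \<and> dvar b = \<tau>x $ j} \<noteq> {}"
      using exists_dens_adm[OF _ v[of j], of "f j" "xb $ j"] ok[of j] by (auto simp: potential_ok_def)
  \<comment> \<open>Boundedness of the constrained set may be read off from any Gibbs density;
    variance 1 is an arbitrary choice.\<close>
  qed (rule bdd_below_min_kl[OF ok zero_less_one])
  finally show ?thesis .
qed

lemma FzSP_eq:
  assumes ok: "\<And>i. potential_ok (f i)" and tau: "\<And>i. 0 < \<tau>p $ i"
  shows "FzSP f zb \<tau>p = ereal (\<Sum>i\<in>UNIV. min_kl_gauss (f i) (zb $ i) (\<tau>p $ i))"
proof -
  have "FzSP f zb \<tau>p = Inf {ereal (\<Sum>i\<in>UNIV. kl1 (f i) (b i) + (dvar (b i) / (2 * \<tau>p $ i) + ln (2 * pi * \<tau>p $ i) / 2)) | b.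
      \<forall>i. b i \<in> {b. dens_adm (f i) b \<and> dmean b = zb $ i}}"
    unfolding FzSP_def KLprod_def Hgauss_def feasible_z_def by (simp add: sum.distrib)
  also have "\<dots> = ereal (\<Sum>i\<in>UNIV. min_kl_gauss (f i) (zb $ i) (\<tau>p $ i))"
    unfolding min_kl_gauss_def
  proof (rule Inf_separable_sum)
    fix i
    show "{b. dens_adm (f i) b \<and> dmean b = zb $ i} \<noteq> {}"
      using exists_dens_adm[of "f i" 1 "zb $ i"] ok[of i] by (auto simp: potential_ok_def)
  qed (rule bdd_below_min_kl_gauss[OF ok tau])
  finally show ?thesis .
qed

text \<open>Moving \<open>A\<close> onto \<open>s\<close> by transposition makes every term a sum
  over coordinates; positivity of both variance vectors keeps all values finite.\<close>

lemma LSP_eq: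
  assumes "\<And>j. potential_ok (fx j)" "\<And>i. potential_ok (fz i)" "\<And>j. 0 < \<tau>x $ j" "\<And>i. 0 < \<tau>p $ i"
  shows "LSP fx fz A xb zb \<tau>x \<tau>p s = ereal ((\<Sum>j\<in>UNIV. min_kl (fx j) (xb $ j) (\<tau>x $ j))
    + (\<Sum>i\<in>UNIV. min_kl_gauss (fz i) (zb $ i) (\<tau>p $ i))
    + (\<Sum>i\<in>UNIV. s $ i * zb $ i) - (\<Sum>j\<in>UNIV. (transpose A *v s) $ j * xb $ j))"
proof -
  have "s \<bullet> (zb - A *v xb) = s \<bullet> zb - (transpose A *v s) \<bullet> xb"
    by (simp add: inner_diff_right dot_lmul_matrix transpose_matrix_vector)
  then show ?thesis
    unfolding LSP_def FxSP_eq[of fx, OF assms(1,3)] FzSP_eq[of fz, OF assms(2,4)]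
    by (simp add: inner_vec_def)
qed

section \<open>The GAMP updates as unique minimizers\<close>

lemma unique_argmin_separable:
  fixes P :: "'n::finite \<Rightarrow> 'a \<Rightarrow> real"
  assumes a: "a \<in> D" and J: "\<And>y. y \<in> D \<Longrightarrow> J y = ereal ((\<Sum>j\<in>UNIV. P j y) + c)"
    and min: "\<And>y j. y \<in> D \<Longrightarrow> P j a \<le> P j y"
    and uniq: "\<And>y. y \<in> D \<Longrightarrow> (\<And>j. P j y = P j a) \<Longrightarrow> y = a"
  shows "unique_argmin J D a"
  unfolding unique_argmin_def
proof (intro conjI ballI impI)
  show le: "J a \<le> J y" if "y \<in> D" for y
    using that min[OF that] by (simp add: J a sum_mono)
  fix y assume y: "y \<in> D" and "J y \<le> J a"
  with le[OF y] have "(\<Sum>j\<in>UNIV. P j a) = (\<Sum>j\<in>UNIV. P j y)" by (simp add: J a)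
  then have "P j a = P j y" for j by (rule sum_mono_inv) (use min[OF y] in auto)
  then show "y = a" using uniq[OF y] by simp
qed (fact a)

text \<open>Since 1/\<tau>r is \<open>transpose (sqm A) *v \<tau>s\<close>, the variance penalty is
  v / (2 \<tau>r) per coordinate. Absorbing the linear term - a x into the square moves its centre
  from \<open>x0\<close> to \<open>r\<close>, and each coordinate becomes a least excess plus a
  constant.\<close>

lemma x_update_unique_argmin:
  fixes A :: "real^'n^'m"
  assumes fx: "\<And>j. potential_ok (fx j)" and fz: "\<And>i. potential_ok (fz i)"
    and tp: "\<And>i. 0 < \<tau>p $ i" and pos: "\<And>j. 0 < (transpose (sqm A) *v \<tau>s) $ j"
    and tr: "\<tau>r = (\<chi> j. 1 / (transpose (sqm A) *v \<tau>s) $ j)"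
    and r: "r = x0 + vmul \<tau>r (transpose A *v s)"
  shows "unique_argmin
         (\<lambda>(xb, \<tau>xb). LSP fx fz A xb z \<tau>xb \<tau>p s
             + ereal ((1/2) * (\<tau>s \<bullet> (sqm A *v \<tau>xb)) + (1/2) * wnorm2 (xb - x0) \<tau>r))
         {(xb, \<tau>xb). \<forall>j. 0 < \<tau>xb $ j} (post_mean fx r \<tau>r, post_var fx r \<tau>r)"
proof -
  define a where "a = transpose A *v s"
  have trp: "0 < \<tau>r $ j" for j using pos by (simp add: tr)
  have rj: "r $ j = x0 $ j + \<tau>r $ j * a $ j" for j by (simp add: r vmul_def a_def)
  define P where "P j y = min_kl (fx j) (fst y $ j) (snd y $ j)
      + (snd y $ j + (fst y $ j - r $ j)\<^sup>2) / (2 * \<tau>r $ j)" for j and y :: "(real^'n) \<times> (real^'n)"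
  define c where "c = (\<Sum>i\<in>UNIV. min_kl_gauss (fz i) (z $ i) (\<tau>p $ i)) + (\<Sum>i\<in>UNIV. s $ i * z $ i)
      - (\<Sum>j\<in>UNIV. a $ j * x0 $ j + \<tau>r $ j * (a $ j)\<^sup>2 / 2)"
  have lin: "\<tau>s \<bullet> (sqm A *v v) = (\<Sum>j\<in>UNIV. v $ j / \<tau>r $ j)" for v
  proof -
    have "\<tau>s \<bullet> (sqm A *v v) = (transpose (sqm A) *v \<tau>s) \<bullet> v"
      by (simp add: dot_lmul_matrix transpose_matrix_vector)
    then show ?thesis by (simp add: inner_vec_def tr mult.commute)
  qed
  show ?thesis
  proof (rule unique_argmin_separable[where P = P and c = c])
    let ?D = "{(xb, \<tau>xb). \<forall>j. 0 < \<tau>xb $ j} :: ((real^'n) \<times> (real^'n)) set"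
    let ?a = "(post_mean fx r \<tau>r, post_var fx r \<tau>r)"
    have Pa: "P j ?a = - ln (gibbs_Z (fx j) (r $ j) (\<tau>r $ j))" for j
      using min_kl_gibbs[OF fx[of j] trp[of j], of "r $ j"] by (simp add: P_def post_mean_def post_var_def)
    show "?a \<in> ?D" using gibbs_dvar_pos[OF fx trp] by (auto simp: post_var_def)
    fix y assume y: "y \<in> ?D"
    obtain xb v where xv: "y = (xb, v)" by fastforce
    have v: "0 < v $ j" for j using y xv by auto
    have sq: "- (a $ j * xb $ j) + v $ j / \<tau>r $ j / 2 + (xb $ j - x0 $ j)\<^sup>2 / \<tau>r $ j / 2
       = (v $ j + (xb $ j - r $ j)\<^sup>2) / (2 * \<tau>r $ j) - (a $ j * x0 $ j + \<tau>r $ j * (a $ j)\<^sup>2 / 2)" for j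
      unfolding rj using trp[of j] by (simp add: field_simps power2_eq_square)
    have "(\<Sum>j\<in>UNIV. min_kl (fx j) (xb $ j) (v $ j)) - (\<Sum>j\<in>UNIV. a $ j * xb $ j)
        + ((1/2) * (\<Sum>j\<in>UNIV. v $ j / \<tau>r $ j) + (1/2) * wnorm2 (xb - x0) \<tau>r)
      = (\<Sum>j\<in>UNIV. min_kl (fx j) (xb $ j) (v $ j)
          + (- (a $ j * xb $ j) + v $ j / \<tau>r $ j / 2 + (xb $ j - x0 $ j)\<^sup>2 / \<tau>r $ j / 2))"
      by (simp add: sum.distrib sum_subtractf sum_negf wnorm2_def sum_divide_distrib)
    also have "\<dots> = (\<Sum>j\<in>UNIV. P j y) - (\<Sum>j\<in>UNIV. a $ j * x0 $ j + \<tau>r $ j * (a $ j)\<^sup>2 / 2)"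
      unfolding sq P_def xv by (simp add: sum_subtractf[symmetric] add_diff_eq)
    finally show "(case y of (xb, \<tau>xb) \<Rightarrow> LSP fx fz A xb z \<tau>xb \<tau>p s
             + ereal ((1/2) * (\<tau>s \<bullet> (sqm A *v \<tau>xb)) + (1/2) * wnorm2 (xb - x0) \<tau>r))
        = ereal ((\<Sum>j\<in>UNIV. P j y) + c)"
      by (simp add: xv LSP_eq[of fx fz, OF fx fz v tp] lin a_def[symmetric] c_def del: transpose_matrix_vector)
    have lower: "P j ?a \<le> P j y" for j
      unfolding Pa using min_kl_lower[OF fx[of j] trp[of j] v[of j], of "xb $ j" "r $ j"] by (simp add: P_def xv)
    then show "P j ?a \<le> P j y" for j .
    assume eq: "\<And>j. P j y = P j ?a"
    have "xb $ j = post_mean fx r \<tau>r $ j \<and> v $ j = post_var fx r \<tau>r $ j" for j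
      using min_kl_unique[OF fx[of j] trp[of j] v[of j], of "xb $ j" "r $ j"] eq[of j]
      unfolding Pa by (simp add: P_def xv post_mean_def post_var_def)
    then show "y = ?a" by (simp add: xv vec_eq_iff)
  qed
qed

text \<open>Here the linear term s z moves the centre of the square from A x to \<open>p\<close>;
  the variance term is already inside the free energy through \<open>Hgauss\<close>.\<close>

lemma z_update_unique_argmin:
  fixes A :: "real^'n^'m"
  assumes fx: "\<And>j. potential_ok (fx j)" and fz: "\<And>i. potential_ok (fz i)"
    and tx: "\<And>j. 0 < \<tau>x $ j" and tp: "\<And>i. 0 < \<tau>p $ i"
    and p: "p = A *v x - vmul s \<tau>p"
  shows "unique_argmin (\<lambda>zb. LSP fx fz A x zb \<tau>x \<tau>p s + ereal ((1/2) * wnorm2 (zb - A *v x) \<tau>p))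
     UNIV (post_mean fz p \<tau>p)"
proof -
  define q where "q = A *v x"
  have pi: "p $ i = q $ i - s $ i * \<tau>p $ i" for i by (simp add: p vmul_def q_def)
  define P where "P i z = min_kl_gauss (fz i) (z $ i) (\<tau>p $ i) + (z $ i - p $ i)\<^sup>2 / (2 * \<tau>p $ i)" for i and z :: "real^'m"
  define c where "c = (\<Sum>j\<in>UNIV. min_kl (fx j) (x $ j) (\<tau>x $ j)) - (\<Sum>j\<in>UNIV. (transpose A *v s) $ j * x $ j)
      + (\<Sum>i\<in>UNIV. s $ i * q $ i - (s $ i)\<^sup>2 * \<tau>p $ i / 2)"
  show ?thesis
  proof (rule unique_argmin_separable[where P = P and c = c])
    let ?a = "post_mean fz p \<tau>p"
    have Pa: "P i ?a = - ln (gibbs_Z (fz i) (p $ i) (\<tau>p $ i)) + ln (2 * pi * \<tau>p $ i) / 2" for i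
      using min_kl_gauss_gibbs[OF fz[of i] tp[of i], of "p $ i"] by (simp add: P_def post_mean_def)
    show "?a \<in> UNIV" by simp
    fix z :: "real^'m"
    have sq: "s $ i * z $ i + (z $ i - q $ i)\<^sup>2 / \<tau>p $ i / 2
       = (z $ i - p $ i)\<^sup>2 / (2 * \<tau>p $ i) + (s $ i * q $ i - (s $ i)\<^sup>2 * \<tau>p $ i / 2)" for i
      unfolding pi using tp[of i] by (simp add: field_simps power2_eq_square)
    have "(\<Sum>i\<in>UNIV. min_kl_gauss (fz i) (z $ i) (\<tau>p $ i)) + (\<Sum>i\<in>UNIV. s $ i * z $ i) + (1/2) * wnorm2 (z - q) \<tau>p
      = (\<Sum>i\<in>UNIV. min_kl_gauss (fz i) (z $ i) (\<tau>p $ i) + (s $ i * z $ i + (z $ i - q $ i)\<^sup>2 / \<tau>p $ i / 2))"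
      by (simp add: sum.distrib wnorm2_def sum_divide_distrib)
    also have "\<dots> = (\<Sum>i\<in>UNIV. P i z) + (\<Sum>i\<in>UNIV. s $ i * q $ i - (s $ i)\<^sup>2 * \<tau>p $ i / 2)"
      unfolding sq P_def by (simp add: sum.distrib[symmetric] add.assoc)
    finally show "LSP fx fz A x z \<tau>x \<tau>p s + ereal ((1/2) * wnorm2 (z - A *v x) \<tau>p) = ereal ((\<Sum>i\<in>UNIV. P i z) + c)"
      by (simp add: LSP_eq[of fx fz, OF fx fz tx tp] q_def[symmetric] c_def)
    show "P i ?a \<le> P i z" for i
      unfolding Pa using min_kl_gauss_lower[OF fz[of i] tp[of i], of "z $ i" "p $ i"] by (simp add: P_def)
    assume eq: "\<And>i. P i z = P i ?a"
    have "z $ i = ?a $ i" for i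
      using min_kl_gauss_unique[OF fz[of i] tp[of i], of "z $ i" "p $ i"] eq[of i]
      unfolding Pa by (simp add: P_def post_mean_def)
    then show "z = ?a" by (simp add: vec_eq_iff)
  qed
qed

section \<open>Partial derivatives of the Lagrangian\<close>

lemma vupd_sum_deriv:
  fixes v :: "real^'n" and F :: "'n \<Rightarrow> real \<Rightarrow> real"
  assumes "(F j has_real_derivative D) (at (v $ j))"
  shows "((\<lambda>u. \<Sum>k\<in>UNIV. F k (vupd v j u $ k)) has_real_derivative D) (at (v $ j))"
proof -
  have "(\<Sum>k\<in>UNIV. F k (vupd v j u $ k)) = F j u + (\<Sum>k\<in>UNIV - {j}. F k (v $ k))" for u
    by (subst sum.remove[of _ j]) (auto simp: vupd_def intro!: sum.cong)
  then show ?thesis using DERIV_add[OF assms DERIV_const] by simp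
qed

lemma vupd_self: "vupd v j (v $ j) = v"
  by (simp add: vupd_def vec_eq_iff)

lemma matrix_vupd_deriv:
  "((\<lambda>u. (M *v vupd v j u) $ k) has_real_derivative M $ k $ j) (at (v $ j))"
  unfolding matrix_vector_mult_def
  using vupd_sum_deriv[of "\<lambda>l u. M $ k $ l * u" j "M $ k $ j" v] by (auto intro!: derivative_eq_intros)

text \<open>The real formula for the Lagrangian needs positive variances, so differentiating it
  along a path requires a whole neighbourhood of positivity; finitely many coordinates give
  one.\<close>

lemma eventually_all_pos:
  fixes T :: "real \<Rightarrow> real^'m"
  assumes "\<And>k. ((\<lambda>u. T u $ k) has_real_derivative D k) (at u0)" "\<And>k. 0 < T u0 $ k"
  shows "\<forall>\<^sub>F u in nhds u0. \<forall>k. 0 < T u $ k"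
proof (rule eventually_all_finite)
  fix k
  have "isCont (\<lambda>u. T u $ k) u0" using assms(1) by (rule DERIV_isCont)
  then have "((\<lambda>u. T u $ k) \<longlongrightarrow> T u0 $ k) (nhds u0)"
    by (simp add: continuous_at tendsto_nhds_iff)
  then show "\<forall>\<^sub>F u in nhds u0. 0 < T u $ k" using assms(2) by (rule order_tendstoD)
qed

text \<open>An arbitrary path of variances is allowed in order to cover the substitution of
  \<open>sqm A *v \<tau>x\<close> for \<open>\<tau>p\<close>, where one coordinate of
  \<open>\<tau>x\<close> moves many of \<open>\<tau>p\<close>.\<close>

lemma min_kl_gauss_path_deriv:
  fixes T :: "real \<Rightarrow> real^'m"
  assumes fz: "\<And>i. potential_ok (fz i)" and tp: "\<And>i. 0 < T u0 $ i"
    and T: "\<And>i. ((\<lambda>u. T u $ i) has_real_derivative D i) (at u0)"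
  shows "((\<lambda>u. \<Sum>i\<in>UNIV. min_kl_gauss (fz i) (post_mean fz p (T u0) $ i) (T u $ i)) has_real_derivative
     (\<Sum>i\<in>UNIV. (1 / T u0 $ i - post_var fz p (T u0) $ i / (T u0 $ i)\<^sup>2) / 2 * D i)) (at u0)"
proof (rule DERIV_sum)
  fix i
  have "((\<lambda>t. min_kl_gauss (fz i) (post_mean fz p (T u0) $ i) t) has_real_derivative
     (1 / T u0 $ i - post_var fz p (T u0) $ i / (T u0 $ i)\<^sup>2) / 2) (at (T u0 $ i))"
    using min_kl_gauss_deriv_tau[OF fz[of i] tp[of i], of "p $ i"] by (simp add: post_mean_def post_var_def)
  from DERIV_chain2[OF this T]
  show "((\<lambda>u. min_kl_gauss (fz i) (post_mean fz p (T u0) $ i) (T u $ i)) has_real_derivative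
     (1 / T u0 $ i - post_var fz p (T u0) $ i / (T u0 $ i)\<^sup>2) / 2 * D i) (at u0)" .
qed

lemma LSP_deriv_tau_p:
  fixes A :: "real^'n^'m"
  assumes fx: "\<And>j. potential_ok (fx j)" and fz: "\<And>i. potential_ok (fz i)"
    and tx: "\<And>j. 0 < \<tau>x $ j" and tp: "\<And>i. 0 < \<tau>p $ i"
  shows "((\<lambda>u. real_of_ereal (LSP fx fz A x (post_mean fz p \<tau>p) \<tau>x (vupd \<tau>p i u) s)) has_real_derivative
     (1 / \<tau>p $ i - post_var fz p \<tau>p $ i / (\<tau>p $ i)\<^sup>2) / 2) (at (\<tau>p $ i))"
proof -
  let ?z = "post_mean fz p \<tau>p"
  let ?D = "(1 / \<tau>p $ i - post_var fz p \<tau>p $ i / (\<tau>p $ i)\<^sup>2) / 2"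
  let ?f = "\<lambda>u. (\<Sum>j\<in>UNIV. min_kl (fx j) (x $ j) (\<tau>x $ j))
    + (\<Sum>k\<in>UNIV. min_kl_gauss (fz k) (?z $ k) (vupd \<tau>p i u $ k))
    + (\<Sum>i\<in>UNIV. s $ i * ?z $ i) - (\<Sum>j\<in>UNIV. (transpose A *v s) $ j * x $ j)"
  have "\<forall>\<^sub>F u in nhds (\<tau>p $ i). 0 < u" using tp[of i] by (intro order_tendstoD(1)[OF filterlim_ident])
  then have ev: "\<forall>\<^sub>F u in nhds (\<tau>p $ i). real_of_ereal (LSP fx fz A x ?z \<tau>x (vupd \<tau>p i u) s) = ?f u"
  proof eventually_elim
    case (elim u)
    have "0 < vupd \<tau>p i u $ k" for k using elim tp by (simp add: vupd_def)
    then show ?case by (simp add: LSP_eq[of fx fz, OF fx fz tx])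
  qed
  have "((\<lambda>t. min_kl_gauss (fz i) (?z $ i) t) has_real_derivative ?D) (at (\<tau>p $ i))"
    using min_kl_gauss_deriv_tau[OF fz[of i] tp[of i], of "p $ i"] by (simp add: post_mean_def post_var_def)
  then have "(?f has_real_derivative ?D) (at (\<tau>p $ i))"
    by (auto intro!: derivative_eq_intros vupd_sum_deriv)
  then show ?thesis using DERIV_cong_ev[OF refl ev refl] by simp
qed

text \<open>The value combines the slope of the free energy with that of the linear term; the update
  of \<open>r\<close> is exactly the condition that it vanish.\<close>

lemma LSP_deriv_x:
  fixes A :: "real^'n^'m"
  assumes fx: "\<And>j. potential_ok (fx j)" and fz: "\<And>i. potential_ok (fz i)"
    and tr: "\<And>j. 0 < \<tau>r $ j" and tp: "\<And>i. 0 < \<tau>p $ i"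
  shows "((\<lambda>u. real_of_ereal (LSP fx fz A (vupd (post_mean fx r \<tau>r) j u) z (post_var fx r \<tau>r) \<tau>p s))
     has_real_derivative (r $ j - post_mean fx r \<tau>r $ j) / \<tau>r $ j - (transpose A *v s) $ j)
     (at (post_mean fx r \<tau>r $ j))"
proof -
  have tx: "0 < post_var fx r \<tau>r $ j" for j using gibbs_dvar_pos[OF fx tr] by (simp add: post_var_def)
  have 1: "((\<lambda>u. min_kl (fx j) u (post_var fx r \<tau>r $ j)) has_real_derivative
      (r $ j - post_mean fx r \<tau>r $ j) / \<tau>r $ j) (at (post_mean fx r \<tau>r $ j))"
    using min_kl_deriv_mean[OF fx[of j] tr[of j], of "r $ j"] by (simp add: post_mean_def post_var_def)
  have 2: "((\<lambda>u. (transpose A *v s) $ j * u) has_real_derivative (transpose A *v s) $ j) (at (post_mean fx r \<tau>r $ j))"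
    by (auto intro!: derivative_eq_intros)
  note d = vupd_sum_deriv[of "\<lambda>j u. min_kl (fx j) u (post_var fx r \<tau>r $ j)", OF 1]
    vupd_sum_deriv[of "\<lambda>j u. (transpose A *v s) $ j * u", OF 2]
  show ?thesis
    unfolding LSP_eq[of fx fz, OF fx fz tx tp] real_of_ereal.simps
    using DERIV_diff[OF DERIV_add[OF DERIV_add[OF d(1) DERIV_const] DERIV_const] d(2)] by simp
qed

lemma LSP_deriv_z:
  fixes A :: "real^'n^'m"
  assumes fx: "\<And>j. potential_ok (fx j)" and fz: "\<And>i. potential_ok (fz i)"
    and tx: "\<And>j. 0 < \<tau>x $ j" and tp: "\<And>i. 0 < \<tau>p $ i"
  shows "((\<lambda>u. real_of_ereal (LSP fx fz A x (vupd (post_mean fz p \<tau>p) i u) \<tau>x \<tau>p s))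
     has_real_derivative (p $ i - post_mean fz p \<tau>p $ i) / \<tau>p $ i + s $ i) (at (post_mean fz p \<tau>p $ i))"
proof -
  have 1: "((\<lambda>u. min_kl_gauss (fz i) u (\<tau>p $ i)) has_real_derivative
      (p $ i - post_mean fz p \<tau>p $ i) / \<tau>p $ i) (at (post_mean fz p \<tau>p $ i))"
    using min_kl_gauss_deriv_mean[OF fz[of i] tp[of i], of "p $ i"] by (simp add: post_mean_def)
  have 2: "((\<lambda>u. s $ i * u) has_real_derivative s $ i) (at (post_mean fz p \<tau>p $ i))"
    by (auto intro!: derivative_eq_intros)
  note d = vupd_sum_deriv[of "\<lambda>i u. min_kl_gauss (fz i) u (\<tau>p $ i)", OF 1]
    vupd_sum_deriv[of "\<lambda>i u. s $ i * u", OF 2]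
  show ?thesis
    unfolding LSP_eq[of fx fz, OF fx fz tx tp] real_of_ereal.simps
    using DERIV_diff[OF DERIV_add[OF DERIV_add[OF DERIV_const d(1)] d(2)] DERIV_const] by simp
qed

text \<open>The variance enters twice: directly through the x free energy, with slope -1/(2
  \<tau>r), and through \<open>\<tau>p\<close> in the z free energy, where the chain rule yields
  half of \<open>transpose (sqm A) *v \<tau>s\<close>.\<close>

lemma LSP_deriv_tau_x:
  fixes A :: "real^'n^'m"
  assumes fx: "\<And>j. potential_ok (fx j)" and fz: "\<And>i. potential_ok (fz i)"
    and tr: "\<And>j. 0 < \<tau>r $ j" and tx: "\<tau>x = post_var fx r \<tau>r"
    and tp: "\<And>i. 0 < \<tau>p $ i" and tp_eq: "\<tau>p = sqm A *v \<tau>x"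
    and ts: "\<tau>s = (\<chi> i. 1 / \<tau>p $ i - post_var fz p \<tau>p $ i / (\<tau>p $ i)^2)"
  shows "((\<lambda>u. real_of_ereal (LSP fx fz A (post_mean fx r \<tau>r) (post_mean fz p \<tau>p) (vupd \<tau>x j u)
       (sqm A *v vupd \<tau>x j u) s)) has_real_derivative
     (transpose (sqm A) *v \<tau>s) $ j / 2 - 1 / (2 * \<tau>r $ j)) (at (\<tau>x $ j))"
proof -
  let ?x = "post_mean fx r \<tau>r" and ?z = "post_mean fz p \<tau>p"
  have txp: "0 < \<tau>x $ j" for j using gibbs_dvar_pos[OF fx tr] by (simp add: post_var_def tx)
  let ?T = "\<lambda>u. sqm A *v vupd \<tau>x j u"
  have T0: "?T (\<tau>x $ j) = \<tau>p" by (simp add: vupd_self tp_eq)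
  let ?f = "\<lambda>u. (\<Sum>k\<in>UNIV. min_kl (fx k) (?x $ k) (vupd \<tau>x j u $ k))
    + (\<Sum>i\<in>UNIV. min_kl_gauss (fz i) (?z $ i) (?T u $ i))
    + (\<Sum>i\<in>UNIV. s $ i * ?z $ i) - (\<Sum>j\<in>UNIV. (transpose A *v s) $ j * ?x $ j)"
  have "\<forall>\<^sub>F u in nhds (\<tau>x $ j). 0 < u" using txp[of j] by (intro order_tendstoD(1)[OF filterlim_ident])
  moreover have "\<forall>\<^sub>F u in nhds (\<tau>x $ j). \<forall>i. 0 < ?T u $ i"
    by (rule eventually_all_pos[OF matrix_vupd_deriv]) (simp add: T0 tp)
  ultimately have ev: "\<forall>\<^sub>F u in nhds (\<tau>x $ j).
      real_of_ereal (LSP fx fz A ?x ?z (vupd \<tau>x j u) (?T u) s) = ?f u"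
  proof eventually_elim
    case (elim u)
    have "0 < vupd \<tau>x j u $ k" for k using elim(1) txp by (simp add: vupd_def)
    then show ?case using elim(2) by (simp add: LSP_eq[of fx fz, OF fx fz])
  qed
  have 1: "((\<lambda>u. min_kl (fx j) (?x $ j) u) has_real_derivative - (1 / (2 * \<tau>r $ j))) (at (\<tau>x $ j))"
    using min_kl_deriv_var[OF fx[of j] tr[of j], of "r $ j"] by (simp add: post_mean_def post_var_def tx)
  have 2: "((\<lambda>u. \<Sum>i\<in>UNIV. min_kl_gauss (fz i) (?z $ i) (?T u $ i)) has_real_derivative
      (\<Sum>i\<in>UNIV. \<tau>s $ i / 2 * sqm A $ i $ j)) (at (\<tau>x $ j))"
    using min_kl_gauss_path_deriv[of fz ?T "\<tau>x $ j", OF fz _ matrix_vupd_deriv, of p] tp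
    unfolding T0 by (simp add: ts)
  have 3: "(\<Sum>i\<in>UNIV. \<tau>s $ i / 2 * sqm A $ i $ j) = (transpose (sqm A) *v \<tau>s) $ j / 2"
    by (simp add: matrix_vector_mult_def transpose_def sum_divide_distrib mult.commute)
  have "(?f has_real_derivative (transpose (sqm A) *v \<tau>s) $ j / 2 - 1 / (2 * \<tau>r $ j)) (at (\<tau>x $ j))"
    by (rule DERIV_cong[OF DERIV_diff[OF DERIV_add[OF DERIV_add[OF
            vupd_sum_deriv[of "\<lambda>k u. min_kl (fx k) (?x $ k) u", OF 1] 2] DERIV_const] DERIV_const]])
      (unfold 3, linarith)
  then show ?thesis using DERIV_cong_ev[OF refl ev refl] by simp
qed

section \<open>Densities attaining the free energies, unique up to null sets\<close>

lemma attains_Fx_post_dens: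
  fixes r \<tau>r :: "real^'n"
  assumes fx: "\<And>j. potential_ok (fx j)" and tr: "\<And>j. 0 < \<tau>r $ j"
  defines "xh \<equiv> post_mean fx r \<tau>r" and "\<tau>xh \<equiv> post_var fx r \<tau>r"
  shows "attains_Fx fx (post_dens fx r \<tau>r) xh \<tau>xh"
    and "attains_Fx fx b xh \<tau>xh \<Longrightarrow> AE u in lborel. b j u = post_dens fx r \<tau>r j u"
proof -
  have v: "0 < \<tau>xh $ j" for j using gibbs_dvar_pos[OF fx tr] by (simp add: post_var_def \<tau>xh_def)
  \<comment> \<open>At the Gibbs moments the gap to the minimum is the excess itself, so attaining
    the minimum means that the nonnegative excesses sum to zero.\<close>
  have kl: "kl1 (fx j) b = excess (fx j) (r $ j) (\<tau>r $ j) b + min_kl (fx j) (xh $ j) (\<tau>xh $ j)"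
    if "dmean b = xh $ j" "dvar b = \<tau>xh $ j" for b j
    unfolding kl1_eq_excess[OF fx[of j] tr[of j], of b "r $ j"] that
    using min_kl_gibbs[OF fx[of j] tr[of j], of "r $ j"] by (simp add: xh_def \<tau>xh_def post_mean_def post_var_def)
  have F: "FxSP fx xh \<tau>xh = ereal (\<Sum>j\<in>UNIV. min_kl (fx j) (xh $ j) (\<tau>xh $ j))"
    by (rule FxSP_eq[of fx, OF fx v])
  show "attains_Fx fx (post_dens fx r \<tau>r) xh \<tau>xh"
    unfolding attains_Fx_def F KLprod_def feasible_x_def
    using gibbs_adm[OF fx tr] kl[of "post_dens fx r \<tau>r j" j for j] excess_gibbs[OF fx tr]
    by (simp add: post_dens_def xh_def \<tau>xh_def post_mean_def post_var_def)
  assume b: "attains_Fx fx b xh \<tau>xh"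
  then have adm: "dens_adm (fx j) (b j)" and mv: "dmean (b j) = xh $ j" "dvar (b j) = \<tau>xh $ j" for j
    by (auto simp: attains_Fx_def feasible_x_def)
  have "(\<Sum>j\<in>UNIV. excess (fx j) (r $ j) (\<tau>r $ j) (b j)) = 0"
    using b by (simp add: attains_Fx_def F KLprod_def kl mv sum.distrib)
  then have "excess (fx j) (r $ j) (\<tau>r $ j) (b j) = 0"
    using excess_nonneg[OF fx tr adm] by (simp add: sum_nonneg_eq_0_iff)
  from excess_eq_0_AE[OF fx tr adm this] show "AE u in lborel. b j u = post_dens fx r \<tau>r j u"
    by (simp add: post_dens_def)
qed

lemma attains_Fz_post_dens:
  fixes p \<tau>p :: "real^'m"
  assumes fz: "\<And>i. potential_ok (fz i)" and tp: "\<And>i. 0 < \<tau>p $ i"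
  defines "zh \<equiv> post_mean fz p \<tau>p"
  shows "attains_Fz fz (post_dens fz p \<tau>p) zh \<tau>p"
    and "attains_Fz fz b zh \<tau>p \<Longrightarrow> AE u in lborel. b i u = post_dens fz p \<tau>p i u"
proof -
  let ?H = "\<lambda>b i. dvar b / (2 * \<tau>p $ i) + ln (2 * pi * \<tau>p $ i) / 2"
  have kl: "kl1 (fz i) b + ?H b i = excess (fz i) (p $ i) (\<tau>p $ i) b + min_kl_gauss (fz i) (zh $ i) (\<tau>p $ i)"
    if "dmean b = zh $ i" for b i
    unfolding kl1_gauss_eq_excess[OF fz[of i] tp[of i], of b "ln (2 * pi * \<tau>p $ i) / 2" "p $ i"] that
    using min_kl_gauss_gibbs[OF fz[of i] tp[of i], of "p $ i"] by (simp add: zh_def post_mean_def)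
  have F: "FzSP fz zh \<tau>p = ereal (\<Sum>i\<in>UNIV. min_kl_gauss (fz i) (zh $ i) (\<tau>p $ i))"
    by (rule FzSP_eq[of fz, OF fz tp])
  have KH: "KLprod fz b + Hgauss b \<tau>p = (\<Sum>i\<in>UNIV. kl1 (fz i) (b i) + ?H (b i) i)" for b
    by (simp add: KLprod_def Hgauss_def sum.distrib)
  show "attains_Fz fz (post_dens fz p \<tau>p) zh \<tau>p"
    unfolding attains_Fz_def F KH feasible_z_def
    using gibbs_adm[OF fz tp] kl[of "post_dens fz p \<tau>p i" i for i] excess_gibbs[OF fz tp]
    by (simp add: post_dens_def zh_def post_mean_def)
  assume b: "attains_Fz fz b zh \<tau>p"
  then have adm: "dens_adm (fz i) (b i)" and m: "dmean (b i) = zh $ i" for i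
    by (auto simp: attains_Fz_def feasible_z_def)
  have "(\<Sum>i\<in>UNIV. kl1 (fz i) (b i) + ?H (b i) i) = (\<Sum>i\<in>UNIV. min_kl_gauss (fz i) (zh $ i) (\<tau>p $ i))"
    using b by (simp add: attains_Fz_def F KH)
  then have "(\<Sum>i\<in>UNIV. excess (fz i) (p $ i) (\<tau>p $ i) (b i)) = 0"
    unfolding kl[OF m] sum.distrib by simp
  then have "excess (fz i) (p $ i) (\<tau>p $ i) (b i) = 0"
    using excess_nonneg[OF fz tp adm] by (simp add: sum_nonneg_eq_0_iff)
  from excess_eq_0_AE[OF fz tp adm this] show "AE u in lborel. b i u = post_dens fz p \<tau>p i u"
    by (simp add: post_dens_def)
qed

section \<open>Iterations and fixed points of sum-product GAMP\<close>

theorem theorem2: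
  fixes A :: "real^'n^'m"
    and fx :: "'n \<Rightarrow> real \<Rightarrow> real" and fz :: "'m \<Rightarrow> real \<Rightarrow> real"
    and x \<tau>x \<tau>r r :: "nat \<Rightarrow> real^'n"
    and \<tau>p p z \<tau>z s \<tau>s :: "nat \<Rightarrow> real^'m"
  assumes fx_ok: "\<forall>j. potential_ok (fx j)"
    and fz_ok: "\<forall>i. potential_ok (fz i)"
    and tx0_pos: "\<forall>j. 0 < \<tau>x 0 $ j"
    and tp_pos: "\<forall>t i. 0 < (sqm A *v \<tau>x t) $ i"
    and tr_pos: "\<forall>t j. 0 < (transpose (sqm A) *v \<tau>s t) $ j"
    and upd_tp: "\<forall>t. \<tau>p t = sqm A *v \<tau>x t"
    and upd_p: "\<forall>t. p t = A *v x t - vmul (sprev s t) (\<tau>p t)"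
    and upd_z: "\<forall>t. z t = post_mean fz (p t) (\<tau>p t)"
    and upd_tz: "\<forall>t. \<tau>z t = post_var fz (p t) (\<tau>p t)"
    and upd_s: "\<forall>t. s t = vdiv (z t - p t) (\<tau>p t)"
    and upd_ts: "\<forall>t. \<tau>s t = (\<chi> i. 1 / \<tau>p t $ i - \<tau>z t $ i / (\<tau>p t $ i)^2)"
    and upd_tr: "\<forall>t. \<tau>r t = (\<chi> j. 1 / (transpose (sqm A) *v \<tau>s t) $ j)"
    and upd_r: "\<forall>t. r t = x t + vmul (\<tau>r t) (transpose A *v s t)"
    and upd_x: "\<forall>t. x (Suc t) = post_mean fx (r t) (\<tau>r t)"
    and upd_tx: "\<forall>t. \<tau>x (Suc t) = post_var fx (r t) (\<tau>r t)"
  shows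
    "(\<forall>t.
       \<comment> \<open>(i)\<close>
       unique_argmin
         (\<lambda>(xb, \<tau>xb). LSP fx fz A xb (z t) \<tau>xb (\<tau>p t) (s t)
             + ereal ((1/2) * (\<tau>s t \<bullet> (sqm A *v \<tau>xb)) + (1/2) * wnorm2 (xb - x t) (\<tau>r t)))
         {(xb, \<tau>xb). \<forall>j. 0 < \<tau>xb $ j}
         (x (Suc t), \<tau>x (Suc t))
     \<and> \<comment> \<open>(ii)\<close>
       \<tau>p t = sqm A *v \<tau>x t
     \<and> unique_argmin
         (\<lambda>zb. LSP fx fz A (x t) zb (\<tau>x t) (\<tau>p t) (sprev s t)
             + ereal ((1/2) * wnorm2 (zb - A *v x t) (\<tau>p t)))
         UNIV (z t)
     \<and> s t = sprev s t + vdiv (z t - A *v x t) (\<tau>p t)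
     \<and> (\<forall>i. ((\<lambda>u. real_of_ereal (LSP fx fz A (x t) (z t) (\<tau>x t) (vupd (\<tau>p t) i u) (s t)))
              has_real_derivative (\<tau>s t $ i / 2)) (at (\<tau>p t $ i))))
   \<and>
    (\<forall>xh zh \<tau>xh \<tau>ph sh ph \<tau>zh \<tau>sh \<tau>rh rh.
       (\<forall>j. 0 < \<tau>xh $ j) \<and> (\<forall>i. 0 < \<tau>ph $ i) \<and> (\<forall>j. 0 < (transpose (sqm A) *v \<tau>sh) $ j) \<and>
       \<tau>ph = sqm A *v \<tau>xh \<and>
       ph = A *v xh - vmul sh \<tau>ph \<and>
       zh = post_mean fz ph \<tau>ph \<and>
       \<tau>zh = post_var fz ph \<tau>ph \<and>
       sh = vdiv (zh - ph) \<tau>ph \<and>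
       \<tau>sh = (\<chi> i. 1 / \<tau>ph $ i - \<tau>zh $ i / (\<tau>ph $ i)^2) \<and>
       \<tau>rh = (\<chi> j. 1 / (transpose (sqm A) *v \<tau>sh) $ j) \<and>
       rh = xh + vmul \<tau>rh (transpose A *v sh) \<and>
       xh = post_mean fx rh \<tau>rh \<and>
       \<tau>xh = post_var fx rh \<tau>rh
     \<longrightarrow>
       zh = A *v xh \<and> \<tau>ph = sqm A *v \<tau>xh
     \<and> (\<forall>j. ((\<lambda>u. real_of_ereal (LSP fx fz A (vupd xh j u) zh \<tau>xh (sqm A *v \<tau>xh) sh))
              has_real_derivative 0) (at (xh $ j)))
     \<and> (\<forall>i. ((\<lambda>u. real_of_ereal (LSP fx fz A xh (vupd zh i u) \<tau>xh (sqm A *v \<tau>xh) sh))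
              has_real_derivative 0) (at (zh $ i)))
     \<and> (\<forall>j. ((\<lambda>u. real_of_ereal (LSP fx fz A xh zh (vupd \<tau>xh j u) (sqm A *v vupd \<tau>xh j u) sh))
              has_real_derivative 0) (at (\<tau>xh $ j)))
     \<and> attains_Fx fx (post_dens fx rh \<tau>rh) xh \<tau>xh
     \<and> (\<forall>b. attains_Fx fx b xh \<tau>xh \<longrightarrow> (\<forall>j. AE u in lborel. b j u = post_dens fx rh \<tau>rh j u))
     \<and> attains_Fz fz (post_dens fz ph \<tau>ph) zh \<tau>ph
     \<and> (\<forall>b. attains_Fz fz b zh \<tau>ph \<longrightarrow> (\<forall>i. AE u in lborel. b i u = post_dens fz ph \<tau>ph i u)))"
proof (intro conjI allI impI; (elim conjE)?)
  have fx: "potential_ok (fx j)" and fz: "potential_ok (fz i)" for i j using fx_ok fz_ok by auto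
  have tp: "0 < \<tau>p t $ i" for t i using tp_pos upd_tp by simp
  have tr: "0 < \<tau>r t $ j" for t j using tr_pos upd_tr by simp
  \<comment> \<open>After the initial value, positivity is inherited from the variances of Gibbs
    densities.\<close>
  have tx: "0 < \<tau>x t $ j" for t j
  proof (cases t)
    case 0
    then show ?thesis using tx0_pos by simp
  next
    case (Suc k)
    then show ?thesis using gibbs_dvar_pos[OF fx tr] upd_tx by (simp add: post_var_def)
  qed
  fix t
  show "unique_argmin
         (\<lambda>(xb, \<tau>xb). LSP fx fz A xb (z t) \<tau>xb (\<tau>p t) (s t)
             + ereal ((1/2) * (\<tau>s t \<bullet> (sqm A *v \<tau>xb)) + (1/2) * wnorm2 (xb - x t) (\<tau>r t)))
         {(xb, \<tau>xb). \<forall>j. 0 < \<tau>xb $ j} (x (Suc t), \<tau>x (Suc t))"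
    unfolding upd_x[rule_format] upd_tx[rule_format]
    by (rule x_update_unique_argmin[OF fx fz tp]) (use tr_pos upd_tr upd_r in auto)
  show "\<tau>p t = sqm A *v \<tau>x t" using upd_tp by simp
  show "unique_argmin
         (\<lambda>zb. LSP fx fz A (x t) zb (\<tau>x t) (\<tau>p t) (sprev s t) + ereal ((1/2) * wnorm2 (zb - A *v x t) (\<tau>p t)))
         UNIV (z t)"
    unfolding upd_z[rule_format] by (rule z_update_unique_argmin[OF fx fz tx tp]) (use upd_p in auto)
  show "s t = sprev s t + vdiv (z t - A *v x t) (\<tau>p t)"
  proof -
    \<comment> \<open>Substituting \<open>p\<close> splits off \<open>sprev s t\<close> from the
      quotient; at t = 0 that term is zero by definition.\<close>
    have "s t $ i = sprev s t $ i + (z t $ i - (A *v x t) $ i) / \<tau>p t $ i" for i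
      unfolding upd_s[rule_format, of t] using tp[of t i]
      by (simp add: vdiv_def upd_p[rule_format, of t] vmul_def field_simps)
    then show ?thesis by (simp add: vec_eq_iff vdiv_def)
  qed
  fix i
  have "\<tau>s t $ i = 1 / \<tau>p t $ i - post_var fz (p t) (\<tau>p t) $ i / (\<tau>p t $ i)\<^sup>2"
    by (simp add: upd_ts[rule_format, of t] upd_tz)
  then show "((\<lambda>u. real_of_ereal (LSP fx fz A (x t) (z t) (\<tau>x t) (vupd (\<tau>p t) i u) (s t)))
              has_real_derivative (\<tau>s t $ i / 2)) (at (\<tau>p t $ i))"
    using LSP_deriv_tau_p[of fx fz, OF fx fz tx tp, of A "x t" "p t" t t i "s t"]
    by (simp add: upd_z)
next
  have fx: "potential_ok (fx j)" and fz: "potential_ok (fz i)" for i j using fx_ok fz_ok by auto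
  fix xh zh \<tau>xh \<tau>ph sh ph \<tau>zh \<tau>sh \<tau>rh rh
  assume txh: "\<forall>j. 0 < \<tau>xh $ j" and "\<forall>i. 0 < \<tau>ph $ i" and pos: "\<forall>j. 0 < (transpose (sqm A) *v \<tau>sh) $ j"
    and tph: "\<tau>ph = sqm A *v \<tau>xh" and ph: "ph = A *v xh - vmul sh \<tau>ph"
    and zh: "zh = post_mean fz ph \<tau>ph" and tzh: "\<tau>zh = post_var fz ph \<tau>ph"
    and sh: "sh = vdiv (zh - ph) \<tau>ph" and tsh: "\<tau>sh = (\<chi> i. 1 / \<tau>ph $ i - \<tau>zh $ i / (\<tau>ph $ i)^2)"
    and trh: "\<tau>rh = (\<chi> j. 1 / (transpose (sqm A) *v \<tau>sh) $ j)"
    and rh: "rh = xh + vmul \<tau>rh (transpose A *v sh)"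
    and xh: "xh = post_mean fx rh \<tau>rh" and tx: "\<tau>xh = post_var fx rh \<tau>rh"
  then have tp: "0 < \<tau>ph $ i" for i by blast
  have tr: "0 < \<tau>rh $ j" for j using pos by (simp add: trh)
  have shi: "sh $ i = (zh $ i - ph $ i) / \<tau>ph $ i" for i by (subst sh) (simp add: vdiv_def)
  have phi: "ph $ i = (A *v xh) $ i - sh $ i * \<tau>ph $ i" for i by (subst ph) (simp add: vmul_def)
  \<comment> \<open>At a fixed point the old and new \<open>s\<close> coincide, so
    \<open>sh $ i * \<tau>ph $ i\<close> equals both zh - ph and A xh - ph in coordinate i.\<close>
  have "zh $ i = (A *v xh) $ i" for i
    using shi[of i] phi[of i] tp[of i] by (simp add: field_simps)
  then show "zh = A *v xh" by (simp add: vec_eq_iff)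
  show "\<tau>ph = sqm A *v \<tau>xh" by (rule tph)
  have rhj: "rh $ j = xh $ j + \<tau>rh $ j * (transpose A *v sh) $ j" for j by (subst rh) (simp add: vmul_def)
  show "((\<lambda>u. real_of_ereal (LSP fx fz A (vupd xh j u) zh \<tau>xh (sqm A *v \<tau>xh) sh)) has_real_derivative 0) (at (xh $ j))" for j
    using LSP_deriv_x[of fx fz, OF fx fz tr tp, of A rh j zh sh] rhj[of j] tr[of j]
    unfolding tph[symmetric] xh[symmetric] tx[symmetric] by simp
  show "((\<lambda>u. real_of_ereal (LSP fx fz A xh (vupd zh i u) \<tau>xh (sqm A *v \<tau>xh) sh)) has_real_derivative 0) (at (zh $ i))" for i
    using LSP_deriv_z[of fx fz \<tau>xh, OF fx fz txh[rule_format] tp, of A xh ph i sh] shi[of i]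
    unfolding tph[symmetric] zh[symmetric] by (simp add: diff_divide_distrib)
  \<comment> \<open>The definition of \<open>\<tau>rh\<close> as a reciprocal makes the two
    contributions of the variance cancel.\<close>
  have "(transpose (sqm A) *v \<tau>sh) $ j / 2 - 1 / (2 * \<tau>rh $ j) = 0" for j by (simp add: trh)
  then show "((\<lambda>u. real_of_ereal (LSP fx fz A xh zh (vupd \<tau>xh j u) (sqm A *v vupd \<tau>xh j u) sh))
      has_real_derivative 0) (at (\<tau>xh $ j))" for j
    using LSP_deriv_tau_x[of fx fz, OF fx fz tr tx tp tph tsh[unfolded tzh], of j sh]
    unfolding xh[symmetric] zh[symmetric] by (simp only:)
  show "attains_Fx fx (post_dens fx rh \<tau>rh) xh \<tau>xh"
    using attains_Fx_post_dens(1)[of fx, OF fx tr, of rh] unfolding xh[symmetric] tx[symmetric] .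
  show "AE u in lborel. b j u = post_dens fx rh \<tau>rh j u" if "attains_Fx fx b xh \<tau>xh" for b j
    using attains_Fx_post_dens(2)[where fx = fx, OF fx tr, where r = rh and b = b and j = j] that unfolding xh[symmetric] tx[symmetric] .
  show "attains_Fz fz (post_dens fz ph \<tau>ph) zh \<tau>ph"
    using attains_Fz_post_dens(1)[of fz, OF fz tp, of ph] unfolding zh[symmetric] .
  show "AE u in lborel. b i u = post_dens fz ph \<tau>ph i u" if "attains_Fz fz b zh \<tau>ph" for b i
    using attains_Fz_post_dens(2)[where fz = fz, OF fz tp, where p = ph and b = b and i = i] that unfolding zh[symmetric] .
qed

end
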